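(* For every integer $k\ge 2$ and every tree $T$ with maximum degree at most $k$, we have $$g(n,T,S_{k+1})=ex(n,T,S_{k+1})-O_{k,T}(1),$$ i.e. there is a constant $c=c(k,T)$ such that $ex(n,T,S_{k+1})-c\le g(n,T,S_{k+1})\le ex(n,T,S_{k+1})$ for all $n$.
   Context: $S_{k+1}$ denotes the star with $k+1$ leaves. For graphs $H,F$, $ex(n,H,F)$ is the maximum number of copies of $H$ (as subgraphs) in an $n$-vertex graph containing no copy of $F$ as a subgraph. For fixed graphs $H$ and $F$, the Constructor–Blocker game is played on the edge set of $K_n$: Constructor and Blocker alternately claim previously unclaimed edges, Constructor moving first. Constructor may only claim an edge if after claiming it his graph (all edges he has claimed) contains no copy of $F$; Blocker may claim any unclaimed edge. The game ends when Constructor cannot claim a further edge or all edges are claimed. The score is the number of copies of $H$ all of whose edges were claimed by Constructor. Constructor maximizes, Blocker minimizes the score; $g(n,H,F)$ is the score under optimal play by both players. *)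

theory Defs
  imports Complex_Main
begin

section \<open>Finite simple graphs\<close>

text \<open>A graph is a pair of a vertex set and a set of edges, an edge being a two-element
  set of vertices.\<close>

type_synonym 'a graph = "'a set \<times> 'a set set"

abbreviation verts :: "'a graph \<Rightarrow> 'a set" where "verts \<equiv> fst"
abbreviation edges :: "'a graph \<Rightarrow> 'a set set" where "edges \<equiv> snd"

definition all_edges :: "'a set \<Rightarrow> 'a set set" where
  "all_edges V = {e. e \<subseteq> V \<and> card e = 2}"

definition fin_graph :: "'a graph \<Rightarrow> bool" where
  "fin_graph G \<longleftrightarrow> finite (verts G) \<and> edges G \<subseteq> all_edges (verts G)"

definition subgraph :: "'a graph \<Rightarrow> 'a graph \<Rightarrow> bool" where
  "subgraph K G \<longleftrightarrow> fin_graph K \<and> fin_graph G \<and> verts K \<subseteq> verts G \<and> edges K \<subseteq> edges G"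

definition isomorphic :: "'a graph \<Rightarrow> 'b graph \<Rightarrow> bool" where
  "isomorphic G H \<longleftrightarrow>
    (\<exists>f. bij_betw f (verts G) (verts H) \<and> edges H = (\<lambda>e. f ` e) ` edges G)"

definition degree :: "'a graph \<Rightarrow> 'a \<Rightarrow> nat" where
  "degree G v = card {e \<in> edges G. v \<in> e}"

definition max_degree :: "'a graph \<Rightarrow> nat" where
  "max_degree G = Max (degree G ` verts G)"

definition connected_graph :: "'a graph \<Rightarrow> bool" where
  "connected_graph G \<longleftrightarrow> verts G \<noteq> {} \<and>
    (\<forall>u \<in> verts G. \<forall>v \<in> verts G. (u, v) \<in> {(x, y). {x, y} \<in> edges G}\<^sup>*)"

text \<open>The list of the successive vertices of a cycle; the last vertex is joined to the first.\<close>

definition is_cycle :: "'a graph \<Rightarrow> 'a list \<Rightarrow> bool" where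
  "is_cycle G vs \<longleftrightarrow> length vs \<ge> 3 \<and> distinct vs \<and> set vs \<subseteq> verts G \<and>
    (\<forall>i < length vs. {vs ! i, vs ! (Suc i mod length vs)} \<in> edges G)"

definition tree :: "'a graph \<Rightarrow> bool" where
  "tree G \<longleftrightarrow> fin_graph G \<and> connected_graph G \<and> (\<nexists>vs. is_cycle G vs)"

text \<open>The parameter is the number of leaves; the centre is the vertex 0.\<close>

definition star :: "nat \<Rightarrow> nat graph" where
  "star m = ({0..m}, {{0, i} | i. i \<in> {1..m}})"


section \<open>Copies and generalized Turan numbers\<close>

text \<open>Copies are counted as subgraphs, not as embeddings. They carry their vertex set, so that
  isolated vertices of the graph being counted are accounted for.\<close>

definition copies :: "'a graph \<Rightarrow> 'b graph \<Rightarrow> 'b graph set" where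
  "copies H G = {K. subgraph K G \<and> isomorphic H K}"

definition contains_copy :: "'a graph \<Rightarrow> 'b graph \<Rightarrow> bool" where
  "contains_copy F G \<longleftrightarrow> copies F G \<noteq> {}"

definition ex_num :: "nat \<Rightarrow> 'a graph \<Rightarrow> 'b graph \<Rightarrow> nat" where
  "ex_num n H F = Max {card (copies H G) | G :: nat graph.
     fin_graph G \<and> verts G = {..<n} \<and> \<not> contains_copy F G}"


section \<open>The Constructor-Blocker game\<close>

text \<open>A position consists of the set \<open>C\<close> of Constructor's edges, the set \<open>B\<close> of Blocker's edges
  and the player to move.\<close>

datatype player = Constructor | Blocker

definition unclaimed :: "nat \<Rightarrow> nat set set \<Rightarrow> nat set set \<Rightarrow> nat set set" where
  "unclaimed n C B = all_edges {..<n} - (C \<union> B)"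

definition constructor_moves ::
  "nat \<Rightarrow> 'b graph \<Rightarrow> nat set set \<Rightarrow> nat set set \<Rightarrow> nat set set" where
  "constructor_moves n F C B =
    {e \<in> unclaimed n C B. \<not> contains_copy F ({..<n}, insert e C)}"

lemma finite_unclaimed: "finite (unclaimed n C B)"
proof -
  have "unclaimed n C B \<subseteq> Pow {..<n}"
    by (auto simp: unclaimed_def all_edges_def)
  then show ?thesis
    by (rule finite_subset) simp
qed

lemma card_unclaimed_less:
  assumes "e \<in> unclaimed n C B"
  shows "card (unclaimed n (insert e C) B) < card (unclaimed n C B)"
    and "card (unclaimed n C (insert e B)) < card (unclaimed n C B)"
proof -
  have "unclaimed n (insert e C) B \<subset> unclaimed n C B"
    and "unclaimed n C (insert e B) \<subset> unclaimed n C B"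
    using assms by (auto simp only: unclaimed_def)
  then show "card (unclaimed n (insert e C) B) < card (unclaimed n C B)"
    and "card (unclaimed n C (insert e B)) < card (unclaimed n C B)"
    by (simp_all add: psubset_card_mono finite_unclaimed)
qed

text \<open>The score under optimal play from a position. If no edge is unclaimed, then Constructor has
  no move either, so the first case covers both ways in which the game ends. In the other two
  cases the maximum and the minimum range over nonempty finite sets.\<close>

function game_value ::
  "nat \<Rightarrow> 'a graph \<Rightarrow> 'b graph \<Rightarrow> player \<Rightarrow> nat set set \<Rightarrow> nat set set \<Rightarrow> nat" where
  "game_value n H F p C B =
    (if constructor_moves n F C B = {} then card (copies H ({..<n}, C))
     else (case p of
       Constructor \<Rightarrow>
         Max ((\<lambda>e. game_value n H F Blocker (insert e C) B) ` constructor_moves n F C B)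
     | Blocker \<Rightarrow>
         Min ((\<lambda>e. game_value n H F Constructor C (insert e B)) ` unclaimed n C B)))"
  by pat_completeness auto
termination
  by (relation "measure (\<lambda>(n, H, F, p, C, B). card (unclaimed n C B))")
    (auto simp: constructor_moves_def intro: card_unclaimed_less)

declare game_value.simps [simp del]

definition game_num :: "nat \<Rightarrow> 'a graph \<Rightarrow> 'b graph \<Rightarrow> nat" where
  "game_num n H F = game_value n H F Constructor {} {}"

end

theory Submission
  imports Defs "HOL-Library.FuncSet"
begin

text \<open>In a graph of maximum degree at most \<open>k\<close>, embedding the tree \<open>T\<close> leaf by leaf shows that at
  most \<open>P\<close> embeddings send a fixed root to a given vertex, with equality whenever the ball around
  that vertex is \<open>k\<close>-regular and the graph has no short cycles. So \<open>ex(n, T, S\<^sub>k\<^sub>+\<^sub>1)\<close> is at most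
  \<open>nP / |Aut T|\<close>, and Constructor only has to build a graph without short cycles in which all but
  boundedly many vertices have degree \<open>k\<close>.

  Let \<open>w(a)\<close> be the degree that \<open>a\<close> is missing, \<open>W\<close> the sum of all \<open>w(a)\<close>, and \<open>S(a)\<close> the sum of
  \<open>w\<close> over the Blocker-neighbours of \<open>a\<close>. Constructor joins a vertex \<open>u\<close> with \<open>w(u) > 0\<close> that
  maximizes \<open>S\<close> to a vertex \<open>v\<close> that maximizes \<open>S\<close> among those with \<open>w(v) > 0\<close> that are far from \<open>u\<close>
  in his graph and not joined to \<open>u\<close> by Blocker. This keeps the sum of \<open>w(a) S(a)\<close> linear in \<open>W\<close>
  and the sum of \<open>w(a) S(a)\<^sup>2\<close> below \<open>W\<^sup>2 / 64\<close>. The latter gives \<open>S(u) \<le> W / 8\<close>, so that a vertex \<open>v\<close>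
  is available as long as \<open>W\<close> exceeds a constant.\<close>


section \<open>Adjacency and walks\<close>

text \<open>A walk of length \<open>j\<close> is a membership in \<open>adj E ^^ j\<close>.
  Distances and short cycles are stated below through walks, since maps that preserve edges carry
  walks to walks of the same length.\<close>

definition adj :: "'a set set \<Rightarrow> 'a rel" where
  "adj E = {(x, y). {x, y} \<in> E}"

definition nbrs :: "'a set set \<Rightarrow> 'a \<Rightarrow> 'a set" where
  "nbrs E x = {y. {x, y} \<in> E}"

lemma adj_iff [simp]: "(x, y) \<in> adj E \<longleftrightarrow> {x, y} \<in> E"
  by (simp add: adj_def)

lemma nbrs_iff [simp]: "y \<in> nbrs E x \<longleftrightarrow> {x, y} \<in> E"
  by (simp add: nbrs_def)

lemma all_edgesD:
  assumes "{x, y} \<in> all_edges V"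
  shows "x \<in> V" "y \<in> V" "x \<noteq> y"
  using assms by (auto simp: all_edges_def)

lemma all_edgesI: "x \<in> V \<Longrightarrow> y \<in> V \<Longrightarrow> x \<noteq> y \<Longrightarrow> {x, y} \<in> all_edges V"
  by (auto simp: all_edges_def)

lemma all_edgesE:
  assumes "e \<in> all_edges V"
  obtains x y where "e = {x, y}" "x \<in> V" "y \<in> V" "x \<noteq> y"
  using assms by (auto simp: all_edges_def card_2_iff)

lemma finite_all_edges: "finite V \<Longrightarrow> finite (all_edges V)"
  by (rule finite_subset[of _ "Pow V"]) (auto simp: all_edges_def)

lemma nbrs_subset: "E \<subseteq> all_edges V \<Longrightarrow> nbrs E x \<subseteq> V"
  using all_edgesD by fastforce

lemma finite_nbrs: "finite V \<Longrightarrow> E \<subseteq> all_edges V \<Longrightarrow> finite (nbrs E x)"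
  by (meson finite_subset nbrs_subset)

lemma relpow_adj_sym: "(x, y) \<in> adj E ^^ j \<Longrightarrow> (y, x) \<in> adj E ^^ j"
proof (induction j arbitrary: y)
  case (Suc j)
  then obtain z where "(x, z) \<in> adj E ^^ j" "(z, y) \<in> adj E" by auto
  then show ?case
    using Suc.IH[of z] relpow_Suc_I2[of y z "adj E" x j] by (simp add: insert_commute)
qed simp

lemma relpow_adj_map:
  assumes "(a, b) \<in> adj E ^^ j" "\<And>x y. {x, y} \<in> E \<Longrightarrow> {f x, f y} \<in> E'"
  shows "(f a, f b) \<in> adj E' ^^ j"
  using assms(1)
proof (induction j arbitrary: b)
  case (Suc j)
  then obtain z where "(a, z) \<in> adj E ^^ j" "{z, b} \<in> E" by auto
  then show ?case using Suc.IH[of z] assms(2) relpow_Suc_I[of "f a" "f z" j "adj E'" "f b"] by simp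
qed simp

lemma relpow_adj_mono: "E \<subseteq> E' \<Longrightarrow> (x, y) \<in> adj E ^^ j \<Longrightarrow> (x, y) \<in> adj E' ^^ j"
  using relpow_adj_map[of x y j E "\<lambda>x. x" E'] by auto


section \<open>Copies and injective homomorphisms\<close>

text \<open>Extensional functions make each embedding a single object, so that cardinalities count
  embeddings.\<close>

definition inj_homs :: "'a graph \<Rightarrow> 'b graph \<Rightarrow> ('a \<Rightarrow> 'b) set" where
  "inj_homs H G = {f \<in> verts H \<rightarrow>\<^sub>E verts G. inj_on f (verts H) \<and> (\<forall>e \<in> edges H. f ` e \<in> edges G)}"

definition image_graph :: "('a \<Rightarrow> 'b) \<Rightarrow> 'a graph \<Rightarrow> 'b graph" where
  "image_graph f H = (f ` verts H, (\<lambda>e. f ` e) ` edges H)"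

definition automorphisms :: "'a graph \<Rightarrow> ('a \<Rightarrow> 'a) set" where
  "automorphisms H = {f \<in> inj_homs H H. image_graph f H = H}"

lemma finite_inj_homs: "finite (verts H) \<Longrightarrow> finite (verts G) \<Longrightarrow> finite (inj_homs H G)"
  by (rule finite_subset[of _ "verts H \<rightarrow>\<^sub>E verts G"]) (auto simp: inj_homs_def finite_PiE)

lemma finite_copies:
  assumes "fin_graph G"
  shows "finite (copies H G)"
proof (rule finite_subset)
  show "copies H G \<subseteq> Pow (verts G) \<times> Pow (edges G)"
    by (auto simp: copies_def subgraph_def)
  show "finite (Pow (verts G) \<times> Pow (edges G))"
    using assms finite_all_edges[of "verts G"] unfolding fin_graph_def
    by (auto intro: finite_subset)
qed

lemma image_graph_in_copies:
  assumes H: "fin_graph H" and G: "fin_graph G" and f: "f \<in> inj_homs H G"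
  shows "image_graph f H \<in> copies H G"
proof -
  have inj: "inj_on f (verts H)" and sub: "f ` verts H \<subseteq> verts G"
    using f by (auto simp: inj_homs_def)
  have "f ` e \<subseteq> f ` verts H \<and> card (f ` e) = 2" if "e \<in> edges H" for e
  proof -
    have "e \<subseteq> verts H" "card e = 2"
      using that H by (auto simp: fin_graph_def all_edges_def)
    then show ?thesis using inj by (metis card_image image_mono inj_on_subset)
  qed
  then have "fin_graph (image_graph f H)"
    using H by (auto simp: fin_graph_def image_graph_def all_edges_def)
  moreover have "isomorphic H (image_graph f H)"
    unfolding isomorphic_def using inj_on_imp_bij_betw[OF inj]
    by (intro exI[of _ f]) (simp add: image_graph_def)
  ultimately show ?thesis
    using G sub f by (auto simp: copies_def subgraph_def image_graph_def inj_homs_def)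
qed

text \<open>Composition with a fixed isomorphism identifies the automorphisms of a graph with the
  homomorphisms onto a given copy.\<close>

lemma card_homs_onto_copy:
  assumes H: "fin_graph H" and K: "K \<in> copies H G"
  shows "card {f \<in> inj_homs H G. image_graph f H = K} = card (automorphisms H)"
proof -
  obtain g where g: "bij_betw g (verts H) (verts K)" and ge: "edges K = (\<lambda>e. g ` e) ` edges H"
    using K by (auto simp: copies_def isomorphic_def)
  have sub: "verts K \<subseteq> verts G" "edges K \<subseteq> edges G"
    using K by (auto simp: copies_def subgraph_def)
  have eH: "e \<subseteq> verts H" if "e \<in> edges H" for e
    using that H by (auto simp: fin_graph_def all_edges_def)
  have ginj: "inj_on g (verts H)" and gim: "g ` verts H = verts K"
    using g by (auto simp: bij_betw_def)
  define g' where "g' = inv_into (verts H) g"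
  have g'g: "g' (g x) = x" if "x \<in> verts H" for x
    using that ginj by (simp add: g'_def)
  have gg': "g (g' y) = y" if "y \<in> verts K" for y
    using that gim by (simp add: g'_def f_inv_into_f)
  have g'K: "g' y \<in> verts H" if "y \<in> verts K" for y
    using that gim by (simp add: g'_def inv_into_into)
  have g'e: "g' ` (g ` e) = e" if "e \<in> edges H" for e
    using eH[OF that] g'g by (force simp: image_image)
  have "bij_betw (\<lambda>h. restrict (\<lambda>x. g (h x)) (verts H)) (automorphisms H)
      {f \<in> inj_homs H G. image_graph f H = K}"
  proof (rule bij_betw_byWitness[where f' = "\<lambda>f. restrict (\<lambda>x. g' (f x)) (verts H)"])
    show "\<forall>h\<in>automorphisms H. restrict (\<lambda>x. g' (restrict (\<lambda>x. g (h x)) (verts H) x)) (verts H) = h"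
      by (force simp: automorphisms_def inj_homs_def g'g fun_eq_iff PiE_def extensional_def)
    show "\<forall>f\<in>{f \<in> inj_homs H G. image_graph f H = K}.
        restrict (\<lambda>x. g (restrict (\<lambda>x. g' (f x)) (verts H) x)) (verts H) = f"
      by (force simp: inj_homs_def image_graph_def gg' fun_eq_iff PiE_def extensional_def)
    show "(\<lambda>h. restrict (\<lambda>x. g (h x)) (verts H)) ` automorphisms H
        \<subseteq> {f \<in> inj_homs H G. image_graph f H = K}"
    proof (rule image_subsetI)
      fix h assume "h \<in> automorphisms H"
      then have h: "h ` verts H = verts H" "(\<lambda>e. h ` e) ` edges H = edges H" "inj_on h (verts H)"
        by (auto simp: automorphisms_def image_graph_def inj_homs_def prod_eq_iff)
      let ?f = "restrict (\<lambda>x. g (h x)) (verts H)"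
      have "?f ` verts H = verts K"
        using h gim by (simp add: image_image[symmetric])
      moreover have "(\<lambda>e. ?f ` e) ` edges H = edges K"
      proof -
        have "(\<lambda>e. ?f ` e) ` edges H = (\<lambda>e. g ` h ` e) ` edges H"
          using eH by (force intro!: image_cong)
        also have "\<dots> = edges K"
          using h(2) ge by (metis image_image)
        finally show ?thesis .
      qed
      moreover have "inj_on ?f (verts H)"
        using comp_inj_on[of h "verts H" g] h(1,3) ginj by (simp add: inj_on_def)
      ultimately show "?f \<in> {f \<in> inj_homs H G. image_graph f H = K}"
        using sub by (auto simp: inj_homs_def image_graph_def prod_eq_iff)
    qed
    show "(\<lambda>f. restrict (\<lambda>x. g' (f x)) (verts H)) ` {f \<in> inj_homs H G. image_graph f H = K}
        \<subseteq> automorphisms H"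
    proof (rule image_subsetI)
      fix f assume "f \<in> {f \<in> inj_homs H G. image_graph f H = K}"
      then have f: "f ` verts H = verts K" "(\<lambda>e. f ` e) ` edges H = edges K" "inj_on f (verts H)"
        by (auto simp: image_graph_def inj_homs_def)
      let ?h = "restrict (\<lambda>x. g' (f x)) (verts H)"
      have g'im: "g' ` verts K = verts H"
        unfolding gim[symmetric] image_image using g'g by simp
      have "?h ` verts H = verts H"
        using f g'im by (simp add: image_image[symmetric])
      moreover have "(\<lambda>e. ?h ` e) ` edges H = edges H"
      proof -
        have "(\<lambda>e. ?h ` e) ` edges H = (\<lambda>e. g' ` f ` e) ` edges H"
          using eH by (force intro!: image_cong)
        also have "\<dots> = (\<lambda>e. g' ` e) ` edges K"
          using f(2) by (metis image_image)
        also have "\<dots> = edges H"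
          using ge g'e by (force simp: image_image)
        finally show ?thesis .
      qed
      moreover have "inj_on ?h (verts H)"
        using f gg' unfolding inj_on_def by (metis imageI restrict_apply')
      ultimately show "?h \<in> automorphisms H"
        by (auto simp: automorphisms_def inj_homs_def image_graph_def prod_eq_iff)
    qed
  qed
  then show ?thesis by (simp add: bij_betw_same_card)
qed

text \<open>Grouping embeddings by their image gives fibres of equal size. Counting copies thus
  becomes counting embeddings, which can be done one vertex at a time.\<close>

lemma card_inj_homs:
  assumes H: "fin_graph H" and G: "fin_graph G"
  shows "card (inj_homs H G) = card (automorphisms H) * card (copies H G)"
proof -
  have fin: "finite (inj_homs H G)"
    using H G by (simp add: finite_inj_homs fin_graph_def)
  have "card (inj_homs H G) = (\<Sum>f \<in> inj_homs H G. 1)"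
    by simp
  also have "\<dots> = (\<Sum>K \<in> copies H G. \<Sum>f \<in> {f \<in> inj_homs H G. image_graph f H = K}. 1)"
    using image_graph_in_copies[OF H G] by (intro sum.group[symmetric] fin finite_copies[OF G]) auto
  also have "\<dots> = (\<Sum>K \<in> copies H G. card (automorphisms H))"
    by (intro sum.cong refl) (simp add: card_homs_onto_copy[OF H])
  finally show ?thesis by simp
qed

lemma card_automorphisms_pos:
  assumes "fin_graph H"
  shows "card (automorphisms H) > 0"
proof -
  have "restrict id (verts H) ` e = e" if "e \<in> edges H" for e
    using that assms by (force simp: fin_graph_def all_edges_def)
  then have "restrict id (verts H) \<in> automorphisms H"
    by (auto simp: automorphisms_def inj_homs_def image_graph_def prod_eq_iff inj_on_def image_iff)
  moreover have "finite (automorphisms H)"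
    unfolding automorphisms_def using assms by (simp add: finite_inj_homs fin_graph_def)
  ultimately show ?thesis by (auto simp: card_gt_0_iff)
qed


section \<open>Growing a tree leaf by leaf\<close>

text \<open>A walk is shortened to a path: whenever the next vertex already occurs, the list is cut
  back to that occurrence.\<close>

lemma adj_path:
  assumes "(p, q) \<in> (adj E)\<^sup>*"
  shows "\<exists>vs. vs \<noteq> [] \<and> hd vs = p \<and> last vs = q \<and> distinct vs \<and>
    set vs \<subseteq> insert p (\<Union>E) \<and> successively (\<lambda>a b. {a, b} \<in> E) vs"
  using assms
proof induction
  case base
  show ?case by (rule exI[of _ "[p]"]) auto
next
  case (step y z)
  then obtain vs where vs: "vs \<noteq> []" "hd vs = p" "last vs = y" "distinct vs"
    "set vs \<subseteq> insert p (\<Union>E)" "successively (\<lambda>a b. {a, b} \<in> E) vs" by blast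
  have yz: "{y, z} \<in> E" using step by simp
  show ?case
  proof (cases "z \<in> set vs")
    case True
    then obtain as bs where split: "vs = (as @ [z]) @ bs" by (auto dest: split_list)
    show ?thesis
    proof (intro exI[of _ "as @ [z]"] conjI)
      show "hd (as @ [z]) = p" using vs(2) split by (cases as) auto
      show "successively (\<lambda>a b. {a, b} \<in> E) (as @ [z])"
        using vs(6) unfolding split by (simp only: successively_append_iff)
    qed (use vs split in auto)
  next
    case False
    then show ?thesis using vs yz
      by (intro exI[of _ "vs @ [z]"]) (auto simp: successively_append_iff)
  qed
qed

text \<open>Each new vertex has exactly one neighbour among the earlier ones, its parent
  \<open>p\<close>. This supplies the induction for counting embeddings.\<close>

inductive grown :: "'a set set \<Rightarrow> 'a \<Rightarrow> 'a set \<Rightarrow> bool" for E t where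
  root: "grown E t {t}"
| leaf: "grown E t S \<Longrightarrow> x \<notin> S \<Longrightarrow> p \<in> S \<Longrightarrow> {p, x} \<in> E
    \<Longrightarrow> (\<And>q. q \<in> S \<Longrightarrow> {q, x} \<in> E \<Longrightarrow> q = p) \<Longrightarrow> grown E t (insert x S)"

lemma grown_finite: "grown E t S \<Longrightarrow> finite S"
  by (induction rule: grown.induct) auto

lemma grown_root: "grown E t S \<Longrightarrow> t \<in> S"
  by (induction rule: grown.induct) auto

text \<open>A new leaf is reached through its parent with one extra step. The walk stays inside
  \<open>S\<close>, so that an embedding defined only on \<open>S\<close> maps it to a walk.\<close>

lemma grown_walk:
  "grown E t S \<Longrightarrow> a \<in> S \<Longrightarrow> b \<in> S \<Longrightarrow> \<exists>j < card S. (a, b) \<in> adj {e \<in> E. e \<subseteq> S} ^^ j"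
proof (induction arbitrary: a b rule: grown.induct)
  case root
  then show ?case by (intro exI[of _ 0]) auto
next
  case (leaf S x p)
  let ?A = "adj {e \<in> E. e \<subseteq> S}" and ?A' = "adj {e \<in> E. e \<subseteq> insert x S}"
  have fin: "finite S" using leaf.hyps(1) by (rule grown_finite)
  have lift: "(c, d) \<in> ?A' ^^ j" if "(c, d) \<in> ?A ^^ j" for c d j
  proof -
    have "{e \<in> E. e \<subseteq> S} \<subseteq> {e \<in> E. e \<subseteq> insert x S}" by auto
    then show ?thesis using that by (rule relpow_adj_mono)
  qed
  have px: "(p, x) \<in> ?A'" using leaf.hyps(3,4) by auto
  have to_x: "\<exists>j < card (insert x S). (c, x) \<in> ?A' ^^ j" if c: "c \<in> S" for c
  proof -
    obtain j where "j < card S" "(c, p) \<in> ?A ^^ j" using leaf.IH[OF c leaf.hyps(3)] by blast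
    then have "Suc j < card (insert x S)" "(c, x) \<in> ?A' ^^ Suc j"
      using relpow_Suc_I[OF lift px] fin leaf.hyps(2) by auto
    then show ?thesis by blast
  qed
  consider "a \<in> S" "b \<in> S" | "a \<in> S" "b = x" | "a = x" "b \<in> S" | "a = x" "b = x"
    using leaf.prems by blast
  then show ?case
  proof cases
    case 1
    then obtain j where "j < card S" "(a, b) \<in> ?A ^^ j" using leaf.IH by blast
    then show ?thesis using lift fin leaf.hyps(2) by (intro exI[of _ j]) auto
  next
    case 3
    then show ?thesis using to_x relpow_adj_sym by metis
  next
    case 4
    then show ?thesis using fin by (intro exI[of _ 0]) (auto simp: card_gt_0_iff)
  qed (use to_x in blast)
qed

text \<open>The path closes up through the outside vertex \<open>x\<close>, which is adjacent to
  both of its ends; \<open>p \<noteq> q\<close> ensures at least three vertices.\<close>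

lemma cycle_from_path:
  assumes x: "x \<in> verts G" "x \<notin> set vs" "{p, x} \<in> edges G" "{q, x} \<in> edges G"
    and pq: "p \<noteq> q" "vs \<noteq> []" "hd vs = p" "last vs = q"
    and vs: "distinct vs" "set vs \<subseteq> verts G" "successively (\<lambda>a b. {a, b} \<in> edges G) vs"
  shows "is_cycle G (x # vs)"
  unfolding is_cycle_def
proof (intro conjI allI impI)
  have "length vs \<noteq> 0" "length vs \<noteq> 1"
    using pq by (auto simp: length_Suc_conv)
  then have "2 \<le> length vs" by linarith
  then show "3 \<le> length (x # vs)" by simp
  show "distinct (x # vs)" "set (x # vs) \<subseteq> verts G" using x vs by auto
  fix i assume i: "i < length (x # vs)"
  show "{(x # vs) ! i, (x # vs) ! (Suc i mod length (x # vs))} \<in> edges G"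
  proof (cases i)
    case 0
    then show ?thesis using pq x by (simp add: hd_conv_nth insert_commute)
  next
    case (Suc l)
    show ?thesis
    proof (cases "i = length vs")
      case True
      then have "(x # vs) ! i = q" using Suc pq by (simp add: last_conv_nth)
      then show ?thesis using True x by (simp add: insert_commute)
    next
      case False
      then have "Suc l < length vs" using i Suc by simp
      then show ?thesis using vs(3) Suc by (simp add: successively_conv_nth)
    qed
  qed
qed

text \<open>A maximal grown set is everything: connectedness supplies an edge leaving a proper
  subset, and acyclicity leaves the outer end of that edge with a single neighbour inside.\<close>

lemma tree_grown:
  assumes T: "tree T" and t: "t \<in> verts T"
  shows "grown (edges T) t (verts T)"
proof -
  let ?V = "verts T" and ?E = "edges T"
  have fin: "finite ?V" and E: "?E \<subseteq> all_edges ?V" and conn: "connected_graph T"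
    and acyclic: "\<And>vs. \<not> is_cycle T vs"
    using T by (auto simp: tree_def fin_graph_def)
  let ?F = "{S. S \<subseteq> ?V \<and> grown ?E t S}"
  have "finite ?F" "{t} \<in> ?F" using fin t by (auto intro: grown.root)
  then have "\<exists>S \<in> ?F. \<forall>S' \<in> ?F. S \<subseteq> S' \<longrightarrow> S = S'" by (intro finite_has_maximal) auto
  then obtain S where S: "S \<in> ?F" and max: "\<And>S'. S' \<in> ?F \<Longrightarrow> S \<subseteq> S' \<Longrightarrow> S' = S"
    by (elim bexE) auto
  have "S = ?V"
  proof (rule ccontr)
    assume "S \<noteq> ?V"
    then obtain z where z: "z \<in> ?V" "z \<notin> S" using S by blast
    have tS: "t \<in> S" using S grown_root[of ?E t S] by simp
    have "(t, z) \<in> (adj ?E)\<^sup>*"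
      using conn t z by (simp add: connected_graph_def adj_def)
    then have "\<exists>p x. p \<in> S \<and> x \<notin> S \<and> {p, x} \<in> ?E"
      using z(2)
    proof (induction)
      case base
      then show ?case using tS by blast
    next
      case (step y z)
      then show ?case by (cases "y \<in> S") auto
    qed
    then obtain p x where px: "p \<in> S" "x \<notin> S" "{p, x} \<in> ?E" by blast
    have xV: "x \<in> ?V" using px(3) E all_edgesD(2)[of p x ?V] by auto
    have unique: "q = p" if q: "q \<in> S" "{q, x} \<in> ?E" for q
    proof (rule ccontr)
      assume "q \<noteq> p"
      have walk: "(p, q) \<in> (adj {e \<in> ?E. e \<subseteq> S})\<^sup>*"
        using grown_walk[of ?E t S p q] S px(1) q(1) by (auto dest: relpow_imp_rtrancl)
      \<comment> \<open>The path uses only edges inside \<open>S\<close>, hence misses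
        \<open>x\<close> and closes up through \<open>x\<close> to a cycle.\<close>
      obtain vs where vs: "vs \<noteq> []" "hd vs = p" "last vs = q" "distinct vs"
        "set vs \<subseteq> insert p (\<Union>{e \<in> ?E. e \<subseteq> S})" "successively (\<lambda>a b. {a, b} \<in> {e \<in> ?E. e \<subseteq> S}) vs"
        using adj_path[OF walk] by (elim exE conjE)
      have "set vs \<subseteq> S" using vs(5) px(1) by blast
      moreover have "successively (\<lambda>a b. {a, b} \<in> ?E) vs"
        using vs(6) by (rule successively_mono) auto
      ultimately have "is_cycle T (x # vs)"
        using \<open>q \<noteq> p\<close> vs px q xV S by (intro cycle_from_path[of x T vs p q]) auto
      then show False using acyclic by blast
    qed
    have "grown ?E t S" using S by simp
    then have "grown ?E t (insert x S)"
      using px(2,1,3) unique by (rule grown.leaf)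
    then have "insert x S = S" using max[of "insert x S"] S xV by blast
    then show False using px(2) by blast
  qed
  then show ?thesis using S by blast
qed


section \<open>Counting homomorphisms with a prescribed root\<close>

text \<open>On a simple graph this excludes the cycles with at most \<open>L + 1\<close> edges: such
  a cycle is an edge together with a walk of length at most \<open>L\<close> around it.\<close>

definition no_short_cycle :: "nat \<Rightarrow> 'a set set \<Rightarrow> bool" where
  "no_short_cycle L E \<longleftrightarrow>
    (\<forall>x y j. {x, y} \<in> E \<longrightarrow> j \<le> L \<longrightarrow> (x, y) \<notin> adj (E - {{x, y}}) ^^ j)"

definition rooted_homs ::
  "'a set set \<Rightarrow> 'a set \<Rightarrow> 'a \<Rightarrow> 'b graph \<Rightarrow> 'b \<Rightarrow> ('a \<Rightarrow> 'b) set" where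
  "rooted_homs E S t G v = {f \<in> S \<rightarrow>\<^sub>E verts G. inj_on f S \<and> f t = v \<and>
     (\<forall>e \<in> E. e \<subseteq> S \<longrightarrow> f ` e \<in> edges G)}"

lemma finite_rooted_homs: "finite S \<Longrightarrow> finite (verts G) \<Longrightarrow> finite (rooted_homs E S t G v)"
  by (rule finite_subset[of _ "S \<rightarrow>\<^sub>E verts G"]) (auto simp: rooted_homs_def finite_PiE)

text \<open>An embedding of \<open>S\<close> extends to \<open>x\<close> in as many ways as
  \<open>f p\<close> has free neighbours, because \<open>{p, x}\<close> is the only edge that the
  new leaf adds.\<close>

lemma card_rooted_homs_leaf:
  assumes E: "E \<subseteq> all_edges U" and G: "fin_graph G"
    and S: "finite S" "t \<in> S" "x \<notin> S" "p \<in> S" "{p, x} \<in> E"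
    and p: "\<And>q. q \<in> S \<Longrightarrow> {q, x} \<in> E \<Longrightarrow> q = p"
  shows "card (rooted_homs E (insert x S) t G v)
    = (\<Sum>f \<in> rooted_homs E S t G v. card (nbrs (edges G) (f p) - f ` S))"
proof -
  let ?R = "rooted_homs E S t G v" and ?R' = "rooted_homs E (insert x S) t G v"
  let ?X = "\<lambda>f. nbrs (edges G) (f p) - f ` S"
  have finG: "finite (verts G)" and EG: "edges G \<subseteq> all_edges (verts G)"
    using G by (auto simp: fin_graph_def)
  have new_edge: "e = {p, x}" if e: "e \<in> E" "e \<subseteq> insert x S" "\<not> e \<subseteq> S" for e
  proof -
    obtain a b where ab: "e = {a, b}" "a \<noteq> b" using e(1) E all_edgesE by blast
    then show ?thesis using e p[of a] p[of b] by (auto simp: insert_commute)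
  qed
  have "bij_betw (\<lambda>(f, y). f(x := y)) (Sigma ?R ?X) ?R'"
  \<comment> \<open>Removing the leaf resets its value to \<open>undefined\<close>, the default
    outside the domain, so that the result is extensional on \<open>S\<close>.\<close>
  proof (rule bij_betw_byWitness[where f' = "\<lambda>g. (g(x := undefined), g x)"])
    show "\<forall>a\<in>Sigma ?R ?X. ((case a of (f, y) \<Rightarrow> f(x := y))(x := undefined),
        (case a of (f, y) \<Rightarrow> f(x := y)) x) = a"
      using S(3) by (auto simp: rooted_homs_def fun_upd_idem PiE_def extensional_def)
    show "\<forall>g\<in>?R'. (case (g(x := undefined), g x) of (f, y) \<Rightarrow> f(x := y)) = g"
      by simp
    show "(\<lambda>(f, y). f(x := y)) ` Sigma ?R ?X \<subseteq> ?R'"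
    proof safe
      fix f y assume f: "f \<in> ?R" and y: "y \<in> nbrs (edges G) (f p)" "y \<notin> f ` S"
      have im: "f(x := y) ` A = f ` A" if "A \<subseteq> S" for A using that S(3) by auto
      have f': "f \<in> S \<rightarrow>\<^sub>E verts G" "inj_on f S" "f t = v" "\<And>e. e \<in> E \<Longrightarrow> e \<subseteq> S \<Longrightarrow> f ` e \<in> edges G"
        using f by (auto simp: rooted_homs_def)
      have yG: "y \<in> verts G" using subsetD[OF nbrs_subset[OF EG] y(1)] .
      have "f(x := y) \<in> insert x S \<rightarrow>\<^sub>E verts G"
        using yG f'(1) by (rule PiE_fun_upd)
      moreover have "inj_on (f(x := y)) (insert x S)"
        using f'(2) y(2) S(3) im[of S] by (auto simp: inj_on_def)
      moreover have "(f(x := y)) t = v" using f'(3) S by auto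
      moreover have "f(x := y) ` e \<in> edges G" if e: "e \<in> E" "e \<subseteq> insert x S" for e
      proof (cases "e \<subseteq> S")
        case True
        then show ?thesis using f'(4) e(1) im by simp
      next
        case False
        then have "e = {p, x}" using new_edge e by blast
        moreover have "p \<noteq> x" using S(3,4) by blast
        then have "f(x := y) ` {p, x} = {f p, y}" by (auto simp: insert_Diff_if)
        ultimately show ?thesis using y(1) by simp
      qed
      ultimately show "f(x := y) \<in> ?R'" by (simp add: rooted_homs_def)
    qed
    show "(\<lambda>g. (g(x := undefined), g x)) ` ?R' \<subseteq> Sigma ?R ?X"
    proof (rule image_subsetI)
      fix g assume "g \<in> ?R'"
      then have g: "g \<in> insert x S \<rightarrow>\<^sub>E verts G" "inj_on g (insert x S)" "g t = v"
        "\<And>e. e \<in> E \<Longrightarrow> e \<subseteq> insert x S \<Longrightarrow> g ` e \<in> edges G"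
        by (auto simp: rooted_homs_def)
      let ?f = "g(x := undefined)"
      have im: "?f ` A = g ` A" if "A \<subseteq> S" for A using that S(3) by auto
      have "?f \<in> S \<rightarrow>\<^sub>E verts G" using S(3) g(1) by (rule fun_upd_in_PiE)
      moreover have "inj_on ?f S" using g(2) S(3) by (auto simp: inj_on_def)
      moreover have "?f t = v" using g(3) S by auto
      moreover have "?f ` e \<in> edges G" if "e \<in> E" "e \<subseteq> S" for e
        using g(4)[of e] that im by auto
      moreover have "g x \<in> nbrs (edges G) (?f p)"
        using g(4)[of "{p, x}"] S by auto
      moreover have "g x \<notin> ?f ` S"
        using im[of S] g(2) S(3) by (auto simp: inj_on_def)
      ultimately show "(?f, g x) \<in> Sigma ?R ?X" by (simp add: rooted_homs_def)
    qed
  qed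
  then have "card ?R' = card (Sigma ?R ?X)" by (simp add: bij_betw_same_card)
  also have "\<dots> = (\<Sum>f \<in> ?R. card (?X f))"
    using finite_nbrs[OF finG EG] by (intro card_SigmaI finite_rooted_homs S finG) auto
  finally show ?thesis .
qed

definition regular_ball :: "nat \<Rightarrow> nat \<Rightarrow> 'a set set \<Rightarrow> 'a \<Rightarrow> bool" where
  "regular_ball k L E v \<longleftrightarrow> (\<forall>j \<le> L. \<forall>y. (v, y) \<in> adj E ^^ j \<longrightarrow> card (nbrs E y) = k)"

text \<open>\<open>P\<close> is a product with one factor per leaf of the growth order and does not
  depend on \<open>G\<close>. The images of the earlier tree neighbours of a parent are always
  occupied, which gives the upper bound; in the regular case without short cycles no other neighbour
  is occupied, so the same \<open>P\<close> is attained.\<close>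

lemma card_rooted_homs:
  assumes "grown E t S" "E \<subseteq> all_edges U"
  shows "\<exists>P. \<forall>(G :: 'b graph) v. fin_graph G \<longrightarrow> (\<forall>y \<in> verts G. card (nbrs (edges G) y) \<le> k) \<longrightarrow>
     v \<in> verts G \<longrightarrow> card (rooted_homs E S t G v) \<le> P \<and>
     (no_short_cycle L (edges G) \<and> regular_ball k L (edges G) v \<and> card S \<le> L
        \<longrightarrow> card (rooted_homs E S t G v) = P)"
  using assms
proof induction
  case root
  have "rooted_homs E {t} t G v = {\<lambda>x\<in>{t}. v}" if "v \<in> verts G" for v and G :: "'b graph"
  proof -
    have "\<not> e \<subseteq> {t}" if "e \<in> E" for e
      using that root card_mono[of "{t}" e] by (auto simp: all_edges_def)
    then show ?thesis
      using that by (auto simp: rooted_homs_def PiE_def extensional_def fun_eq_iff)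
  qed
  then show ?case by (intro exI[of _ 1]) auto
next
  case (leaf S x p)
  obtain P where P_all: "\<forall>(G :: 'b graph) v. fin_graph G \<longrightarrow> (\<forall>y \<in> verts G. card (nbrs (edges G) y) \<le> k) \<longrightarrow>
     v \<in> verts G \<longrightarrow> card (rooted_homs E S t G v) \<le> P \<and>
     (no_short_cycle L (edges G) \<and> regular_ball k L (edges G) v \<and> card S \<le> L
        \<longrightarrow> card (rooted_homs E S t G v) = P)"
    using leaf.IH[OF leaf.prems] by (elim exE)
  note P = P_all[THEN spec, THEN spec, THEN mp, THEN mp, THEN mp]
  have S: "finite S" "t \<in> S" using grown_finite[OF leaf.hyps(1)] grown_root[OF leaf.hyps(1)] by auto
  \<comment> \<open>\<open>D\<close> consists of the neighbours of the parent placed before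
    \<open>x\<close>; their images use up \<open>card D\<close> neighbours of
    \<open>f p\<close>.\<close>
  define D where "D = {q \<in> S. {p, q} \<in> E}"
  show ?case
  proof (intro exI[of _ "P * (k - card D)"] allI impI conjI)
    fix G :: "'b graph" and v
    assume G: "fin_graph G" and deg: "\<forall>y \<in> verts G. card (nbrs (edges G) y) \<le> k"
      and v: "v \<in> verts G"
    have finG: "finite (verts G)" and EG: "edges G \<subseteq> all_edges (verts G)"
      using G by (auto simp: fin_graph_def)
    let ?R = "rooted_homs E S t G v"
    have step: "card (rooted_homs E (insert x S) t G v)
        = (\<Sum>f \<in> ?R. card (nbrs (edges G) (f p) - f ` S))"
      by (rule card_rooted_homs_leaf[OF leaf.prems G S leaf.hyps(2-5)])
    have im_D: "f ` D \<subseteq> nbrs (edges G) (f p) \<inter> f ` S" "card (f ` D) = card D" if f: "f \<in> ?R" for f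
    proof -
      have "{f p, f q} \<in> edges G" if "q \<in> D" for q
      proof -
        have "{p, q} \<in> E" "{p, q} \<subseteq> S" using that leaf.hyps(3) by (auto simp: D_def)
        moreover have "\<forall>e \<in> E. e \<subseteq> S \<longrightarrow> f ` e \<in> edges G" using f by (simp add: rooted_homs_def)
        ultimately have "f ` {p, q} \<in> edges G" by metis
        then show ?thesis by simp
      qed
      then show "f ` D \<subseteq> nbrs (edges G) (f p) \<inter> f ` S" by (auto simp: D_def)
      have "inj_on f S" "D \<subseteq> S" using f by (auto simp: rooted_homs_def D_def)
      then show "card (f ` D) = card D" by (intro card_image) (rule inj_on_subset)
    qed
    have fp: "f p \<in> verts G" if "f \<in> ?R" for f
      using that leaf.hyps(3) by (auto simp: rooted_homs_def)
    have "card (nbrs (edges G) (f p) - f ` S) \<le> k - card D" if f: "f \<in> ?R" for f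
    proof -
      have "card (nbrs (edges G) (f p) - f ` S) \<le> card (nbrs (edges G) (f p) - f ` D)"
        using im_D[OF f] finite_nbrs[OF finG EG] by (intro card_mono) auto
      also have "\<dots> = card (nbrs (edges G) (f p)) - card D"
        using im_D[OF f] S by (subst card_Diff_subset) (auto simp: D_def)
      also have "\<dots> \<le> k - card D" using deg fp[OF f] by (simp add: diff_le_mono)
      finally show ?thesis .
    qed
    then have "card (rooted_homs E (insert x S) t G v) \<le> card ?R * (k - card D)"
      unfolding step using sum_bounded_above[of ?R "\<lambda>f. card (nbrs (edges G) (f p) - f ` S)" "k - card D"]
      by simp
    also have "\<dots> \<le> P * (k - card D)" using P[OF G deg v] by simp
    finally show "card (rooted_homs E (insert x S) t G v) \<le> P * (k - card D)" .
    assume good: "no_short_cycle L (edges G) \<and> regular_ball k L (edges G) v \<and> card (insert x S) \<le> L"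
    have cardS: "card S \<le> L" using good S leaf.hyps(2) by simp
    have "card (nbrs (edges G) (f p) - f ` S) = k - card D" if f: "f \<in> ?R" for f
    proof -
      have f': "inj_on f S" "f t = v" "\<And>e. e \<in> E \<Longrightarrow> e \<subseteq> S \<Longrightarrow> f ` e \<in> edges G"
        using f by (auto simp: rooted_homs_def)
      \<comment> \<open>An adjacency of \<open>f p\<close> and \<open>f q\<close> that does not come
        from a tree edge is a chord: the image of the tree walk from \<open>p\<close> to
        \<open>q\<close> avoids it and has length at most \<open>L\<close>, against
        \<open>no_short_cycle\<close>.\<close>
      have "q \<in> D" if q: "q \<in> S" "{f p, f q} \<in> edges G" for q
      proof (rule ccontr)
        assume "q \<notin> D"
        then have pq: "{p, q} \<notin> E" using q by (simp add: D_def)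
        obtain j where j: "j < card S" "(p, q) \<in> adj {e \<in> E. e \<subseteq> S} ^^ j"
          using grown_walk[OF leaf.hyps(1,3) q(1)] by blast
        have "(f p, f q) \<in> adj (edges G - {{f p, f q}}) ^^ j"
        proof (rule relpow_adj_map[OF j(2)])
          fix a b assume ab: "{a, b} \<in> {e \<in> E. e \<subseteq> S}"
          then have "f ` {a, b} \<in> edges G" using f'(3) by blast
          moreover have "{a, b} \<noteq> {p, q}" using pq ab by auto
          then have "f ` {a, b} \<noteq> f ` {p, q}"
            using inj_on_image_eq_iff[OF f'(1), of "{a, b}" "{p, q}"] ab q(1) leaf.hyps(3) by auto
          ultimately show "{f a, f b} \<in> edges G - {{f p, f q}}" by simp
        qed
        then show False
          using good j(1) cardS q(2) unfolding no_short_cycle_def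
          by (meson less_or_eq_imp_le order_less_le_trans)
      qed
      then have "nbrs (edges G) (f p) \<inter> f ` S = f ` D"
        using im_D[OF f] by auto
      \<comment> \<open>The tree walk from the root to \<open>p\<close> has length at most
        \<open>L\<close>, so \<open>f p\<close> lies in the regular ball around
        \<open>v\<close>.\<close>
      moreover have "card (nbrs (edges G) (f p)) = k"
      proof -
        obtain j where j: "j < card S" "(t, p) \<in> adj {e \<in> E. e \<subseteq> S} ^^ j"
          using grown_walk[OF leaf.hyps(1) S(2) leaf.hyps(3)] by blast
        have "(f t, f p) \<in> adj (edges G) ^^ j"
        proof (rule relpow_adj_map[OF j(2)])
          fix a b assume "{a, b} \<in> {e \<in> E. e \<subseteq> S}"
          then have "f ` {a, b} \<in> edges G" using f'(3) by blast
          then show "{f a, f b} \<in> edges G" by simp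
        qed
        moreover have "j \<le> L" using j(1) cardS by simp
        ultimately show ?thesis using good f'(2) unfolding regular_ball_def by blast
      qed
      ultimately show ?thesis
        using im_D(2)[OF f] S
        by (metis card_Diff_subset_Int finite_Int finite_imageI)
    qed
    then have "card (rooted_homs E (insert x S) t G v) = card ?R * (k - card D)"
      unfolding step by simp
    then show "card (rooted_homs E (insert x S) t G v) = P * (k - card D)"
      using P[OF G deg v] good cardS by simp
  qed
qed

lemma card_inj_homs_rooted:
  assumes H: "fin_graph H" "t \<in> verts H" and G: "finite (verts G)"
  shows "card (inj_homs H G) = (\<Sum>v \<in> verts G. card (rooted_homs (edges H) (verts H) t G v))"
proof -
  have eH: "e \<subseteq> verts H" if "e \<in> edges H" for e
    using that H by (auto simp: fin_graph_def all_edges_def)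
  have "inj_homs H G = (\<Union>v \<in> verts G. rooted_homs (edges H) (verts H) t G v)"
    using H(2) eH by (auto simp: inj_homs_def rooted_homs_def)
  moreover have "card (\<Union>v \<in> verts G. rooted_homs (edges H) (verts H) t G v)
      = (\<Sum>v \<in> verts G. card (rooted_homs (edges H) (verts H) t G v))"
    using H G by (intro card_UN_disjoint ballI finite_rooted_homs)
      (auto simp: rooted_homs_def fin_graph_def)
  ultimately show ?thesis by simp
qed

text \<open>Summation over the image of a fixed root: every vertex contributes at most
  \<open>P\<close>, and one with a regular ball contributes exactly \<open>P\<close> if there are no
  short cycles.\<close>

lemma tree_homs_count:
  assumes T: "tree (T :: 'a graph)"
  shows "\<exists>P. \<forall>G :: 'b graph. fin_graph G \<longrightarrow> (\<forall>y \<in> verts G. card (nbrs (edges G) y) \<le> k) \<longrightarrow>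
    card (inj_homs T G) \<le> card (verts G) * P \<and> (no_short_cycle (card (verts T)) (edges G) \<longrightarrow>
      card {v \<in> verts G. regular_ball k (card (verts T)) (edges G) v} * P \<le> card (inj_homs T G))"
proof -
  let ?L = "card (verts T)"
  have fin: "fin_graph T" and "verts T \<noteq> {}"
    using T by (auto simp: tree_def connected_graph_def)
  then obtain t where t: "t \<in> verts T" by blast
  let ?N = "\<lambda>(G :: 'b graph) v. card (rooted_homs (edges T) (verts T) t G v)"
  have "edges T \<subseteq> all_edges (verts T)" using fin by (simp add: fin_graph_def)
  from card_rooted_homs[OF tree_grown[OF T t] this, where k = k and L = ?L and 'b = 'b]
  obtain P where P: "\<And>(G :: 'b graph) v. fin_graph G \<Longrightarrow> (\<forall>y \<in> verts G. card (nbrs (edges G) y) \<le> k)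
      \<Longrightarrow> v \<in> verts G \<Longrightarrow> ?N G v \<le> P \<and>
     (no_short_cycle ?L (edges G) \<and> regular_ball k ?L (edges G) v \<longrightarrow> ?N G v = P)"
    by (meson order.refl)
  show ?thesis
  proof (intro exI[of _ P] allI impI conjI)
    fix G :: "'b graph"
    assume G: "fin_graph G" and deg: "\<forall>y \<in> verts G. card (nbrs (edges G) y) \<le> k"
    have finG: "finite (verts G)" using G by (simp add: fin_graph_def)
    have homs: "card (inj_homs T G) = (\<Sum>v \<in> verts G. ?N G v)"
      using fin t finG by (rule card_inj_homs_rooted)
    show "card (inj_homs T G) \<le> card (verts G) * P"
      unfolding homs using sum_bounded_above[of "verts G" "?N G" P] P[OF G] deg by auto
    assume short: "no_short_cycle ?L (edges G)"
    let ?good = "{v \<in> verts G. regular_ball k ?L (edges G) v}"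
    have "card ?good * P = (\<Sum>v \<in> ?good. ?N G v)"
      using P[OF G] deg short by simp
    also have "\<dots> \<le> (\<Sum>v \<in> verts G. ?N G v)"
      using finG by (intro sum_mono2) auto
    finally show "card ?good * P \<le> card (inj_homs T G)" unfolding homs .
  qed
qed


section \<open>Two potentials for Blocker's edges\<close>

definition weight_deg :: "'a set \<Rightarrow> 'a set set \<Rightarrow> ('a \<Rightarrow> real) \<Rightarrow> 'a \<Rightarrow> real" where
  "weight_deg V B w a = (\<Sum>b\<in>V. if {a, b} \<in> B then w b else 0)"

text \<open>Each edge \<open>{a, b}\<close> of \<open>B\<close> with distinct ends in
  \<open>V\<close> contributes \<open>2 * w a * w b\<close>.\<close>

definition linear_pot :: "'a set \<Rightarrow> 'a set set \<Rightarrow> ('a \<Rightarrow> real) \<Rightarrow> real" where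
  "linear_pot V B w = (\<Sum>a\<in>V. w a * weight_deg V B w a)"

definition square_pot :: "'a set \<Rightarrow> 'a set set \<Rightarrow> ('a \<Rightarrow> real) \<Rightarrow> real" where
  "square_pot V B w = (\<Sum>a\<in>V. w a * (weight_deg V B w a)\<^sup>2)"

definition drop_at :: "'a \<Rightarrow> 'a \<Rightarrow> ('a \<Rightarrow> real) \<Rightarrow> 'a \<Rightarrow> real" where
  "drop_at u v w = (\<lambda>a. w a - of_bool (a = u) - of_bool (a = v))"

section \<open>Effect of a single move on the potentials\<close>

lemma weight_deg_nonneg: "(\<And>b. b \<in> V \<Longrightarrow> 0 \<le> w b) \<Longrightarrow> 0 \<le> weight_deg V B w a"
  unfolding weight_deg_def by (intro sum_nonneg) auto

lemma weight_deg_mono: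
  assumes "B \<subseteq> B'" "\<And>b. b \<in> V \<Longrightarrow> 0 \<le> w b" "\<And>b. b \<in> V \<Longrightarrow> w b \<le> w' b"
  shows "weight_deg V B w a \<le> weight_deg V B' w' a"
  unfolding weight_deg_def
proof (rule sum_mono)
  fix b assume "b \<in> V"
  then show "(if {a, b} \<in> B then w b else 0) \<le> (if {a, b} \<in> B' then w' b else 0)"
    using assms(1) assms(2)[of b] assms(3)[of b] by auto
qed

lemma sum_drop_at:
  assumes "finite V" "u \<in> V" "v \<in> V"
  shows "(\<Sum>a\<in>V. drop_at u v w a * f a) = (\<Sum>a\<in>V. w a * f a) - f u - f v"
  using assms
  by (simp add: drop_at_def left_diff_distrib sum_subtractf of_bool_def if_distrib[of "\<lambda>x. x * _"]
      sum.delta cong: if_cong)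

lemma weight_deg_drop_at:
  assumes "finite V" "u \<in> V" "v \<in> V"
  shows "weight_deg V B (drop_at u v w) a
    = weight_deg V B w a - of_bool ({a, u} \<in> B) - of_bool ({a, v} \<in> B)"
proof -
  have *: "(if {a, b} \<in> B then f b else 0) = f b * of_bool ({a, b} \<in> B)" for f :: "'a \<Rightarrow> real" and b
    by simp
  show ?thesis
    unfolding weight_deg_def * using assms by (rule sum_drop_at)
qed

text \<open>Lowering the weights changes both factors. By the symmetry of adjacency each change
  costs the weighted degrees of \<open>u\<close> and \<open>v\<close>; those for the new weights
  equal the old ones, because \<open>{u, v}\<close> is not in \<open>B\<close>.\<close>

lemma linear_pot_drop_at:
  assumes "finite V" "u \<in> V" "v \<in> V"
    and B: "{u, v} \<notin> B" "{u} \<notin> B" "{v} \<notin> B"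
  shows "linear_pot V B (drop_at u v w)
    = linear_pot V B w - 2 * weight_deg V B w u - 2 * weight_deg V B w v"
proof -
  let ?w = "drop_at u v w" and ?S = "weight_deg V B"
  have sym: "(\<Sum>a\<in>V. ?w a * of_bool ({a, x} \<in> B)) = ?S ?w x" for x
    unfolding weight_deg_def by (intro sum.cong) (auto simp: insert_commute)
  have "linear_pot V B ?w
      = (\<Sum>a\<in>V. ?w a * (?S w a - of_bool ({a, u} \<in> B) - of_bool ({a, v} \<in> B)))"
    unfolding linear_pot_def weight_deg_drop_at[OF assms(1-3)] ..
  also have "\<dots> = (\<Sum>a\<in>V. ?w a * ?S w a) - (\<Sum>a\<in>V. ?w a * of_bool ({a, u} \<in> B))
      - (\<Sum>a\<in>V. ?w a * of_bool ({a, v} \<in> B))"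
    by (simp only: right_diff_distrib sum_subtractf)
  also have "\<dots> = linear_pot V B w - ?S w u - ?S w v - ?S ?w u - ?S ?w v"
    unfolding sym unfolding sum_drop_at[OF assms(1-3)] linear_pot_def ..
  also have "?S ?w u = ?S w u"
    using B weight_deg_drop_at[OF assms(1-3), of B w u] by simp
  also have "?S ?w v = ?S w v"
    using B weight_deg_drop_at[OF assms(1-3), of B w v] by (simp add: insert_commute)
  finally show ?thesis by simp
qed

text \<open>The edge \<open>{x, y}\<close> adds the weight of either end to the other. The inclusion
  for \<open>B'\<close> also covers \<open>B' = B\<close>, the position before Blocker's
  reply.\<close>

lemma weight_deg_insert_le:
  assumes "finite V" "x \<in> V" "y \<in> V" "x \<noteq> y" "B' \<subseteq> insert {x, y} B"
    and w: "\<And>b. b \<in> V \<Longrightarrow> 0 \<le> w b" "\<And>b. b \<in> V \<Longrightarrow> w b \<le> k"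
  shows "weight_deg V B' w a \<le> weight_deg V B w a + k * of_bool (a = x) + k * of_bool (a = y)"
proof -
  have k: "0 \<le> k" using w[of x] assms(2) by linarith
  have "weight_deg V B' w a \<le> (\<Sum>b\<in>V. (if {a, b} \<in> B then w b else 0)
      + (if b = y then w y * of_bool (a = x) else 0) + (if b = x then w x * of_bool (a = y) else 0))"
    unfolding weight_deg_def
  proof (rule sum_mono)
    fix b assume "b \<in> V"
    then show "(if {a, b} \<in> B' then w b else 0) \<le> (if {a, b} \<in> B then w b else 0)
      + (if b = y then w y * of_bool (a = x) else 0) + (if b = x then w x * of_bool (a = y) else 0)"
      using assms(2-5) w(1)[of b] w(1)[of x] w(1)[of y] by (auto simp: doubleton_eq_iff)
  qed
  also have "\<dots> = weight_deg V B w a + w y * of_bool (a = x) + w x * of_bool (a = y)"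
    using assms(1-3) by (simp add: sum.distrib weight_deg_def)
  also have "\<dots> \<le> weight_deg V B w a + k * of_bool (a = x) + k * of_bool (a = y)"
    using w(2)[of x] w(2)[of y] assms(2,3) by auto
  finally show ?thesis .
qed

lemma linear_pot_insert_le:
  assumes "finite V" "x \<in> V" "y \<in> V" "x \<noteq> y" "B' \<subseteq> insert {x, y} B"
    and w: "\<And>b. b \<in> V \<Longrightarrow> 0 \<le> w b" "\<And>b. b \<in> V \<Longrightarrow> w b \<le> k"
  shows "linear_pot V B' w \<le> linear_pot V B w + 2 * k\<^sup>2"
proof -
  have k: "0 \<le> k" using w[of x] assms(2) by linarith
  have "linear_pot V B' w
      \<le> (\<Sum>a\<in>V. w a * (weight_deg V B w a + k * of_bool (a = x) + k * of_bool (a = y)))"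
    unfolding linear_pot_def
    using weight_deg_insert_le[OF assms] w by (intro sum_mono mult_left_mono) auto
  also have "\<dots> = (\<Sum>a\<in>V. w a * weight_deg V B w a + (if a = x then w x * k else 0)
      + (if a = y then w y * k else 0))"
    by (intro sum.cong) (auto simp: algebra_simps)
  also have "\<dots> = linear_pot V B w + w x * k + w y * k"
    using assms(1-3) by (simp add: sum.distrib linear_pot_def)
  also have "\<dots> \<le> linear_pot V B w + k * k + k * k"
    using w assms(2,3) k by (intro add_mono mult_right_mono) auto
  finally show ?thesis by (simp add: power2_eq_square)
qed

text \<open>At either end of the new edge the square grows by at most
  \<open>2 * k * s + k\<^sup>2\<close>, counted with weight at most \<open>k\<close>. An end of
  weight zero contributes nothing, so a bound \<open>s\<close> on the vertices of positive weight
  suffices.\<close>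

lemma square_pot_insert_le:
  assumes "finite V" "x \<in> V" "y \<in> V" "x \<noteq> y" "B' \<subseteq> insert {x, y} B"
    and w: "\<And>b. b \<in> V \<Longrightarrow> 0 \<le> w b" "\<And>b. b \<in> V \<Longrightarrow> w b \<le> k"
    and s: "\<And>a. a \<in> V \<Longrightarrow> 0 < w a \<Longrightarrow> weight_deg V B w a \<le> s" "0 \<le> s"
  shows "square_pot V B' w \<le> square_pot V B w + 4 * k\<^sup>2 * s + 2 * k ^ 3"
proof -
  let ?S = "weight_deg V B w"
  have k: "0 \<le> k" using w[of x] assms(2) by linarith
  have "square_pot V B' w
      \<le> (\<Sum>a\<in>V. w a * (?S a + k * of_bool (a = x) + k * of_bool (a = y))\<^sup>2)"
    unfolding square_pot_def
    using weight_deg_insert_le[OF assms(1-7)] w weight_deg_nonneg[OF w(1)]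
    by (intro sum_mono mult_left_mono power_mono) auto
  also have "\<dots> = (\<Sum>a\<in>V. w a * (?S a)\<^sup>2 + (if a = x then w x * (2 * k * ?S x + k\<^sup>2) else 0)
      + (if a = y then w y * (2 * k * ?S y + k\<^sup>2) else 0))"
    using assms(4) by (intro sum.cong) (auto simp: algebra_simps power2_eq_square)
  also have "\<dots> = square_pot V B w + w x * (2 * k * ?S x + k\<^sup>2) + w y * (2 * k * ?S y + k\<^sup>2)"
    using assms(1-3) by (simp add: sum.distrib square_pot_def)
  also have "\<dots> \<le> square_pot V B w + k * (2 * k * s + k\<^sup>2) + k * (2 * k * s + k\<^sup>2)"
  proof -
    have "w a * (2 * k * ?S a + k\<^sup>2) \<le> k * (2 * k * s + k\<^sup>2)" if a: "a \<in> V" for a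
    proof (cases "w a = 0")
      case False
      then have "?S a \<le> s" using s(1)[OF a] w(1)[OF a] by simp
      then show ?thesis
        using w(2)[OF a] w(1) a k weight_deg_nonneg[of V w B a]
        by (intro mult_mono add_mono mult_left_mono) auto
    qed (use s k in auto)
    then show ?thesis using assms(2,3) by (intro add_mono) auto
  qed
  finally show ?thesis by (simp add: algebra_simps power2_eq_square power3_eq_cube)
qed

text \<open>Weighted degrees only decrease and may be frozen at their old values. The drop in weight
  then removes the squares at \<open>u\<close> and \<open>v\<close>, and only the first of these
  gains is kept.\<close>

lemma square_pot_drop_at_le:
  assumes "finite V" "u \<in> V" "v \<in> V"
    and w: "\<And>b. b \<in> V \<Longrightarrow> 0 \<le> w b" and w': "\<And>b. b \<in> V \<Longrightarrow> 0 \<le> drop_at u v w b"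
  shows "square_pot V B (drop_at u v w) \<le> square_pot V B w - (weight_deg V B w u)\<^sup>2"
proof -
  have "square_pot V B (drop_at u v w) \<le> (\<Sum>a\<in>V. drop_at u v w a * (weight_deg V B w a)\<^sup>2)"
    unfolding square_pot_def using w w'
    by (intro sum_mono mult_left_mono power_mono weight_deg_mono weight_deg_nonneg)
      (auto simp: drop_at_def)
  also have "\<dots> = square_pot V B w - (weight_deg V B w u)\<^sup>2 - (weight_deg V B w v)\<^sup>2"
    unfolding square_pot_def by (rule sum_drop_at[OF assms(1-3)])
  finally show ?thesis
    using zero_le_power2[of "weight_deg V B w v"] by linarith
qed

section \<open>Bounds through the largest weighted degree\<close>

lemma finite_argmax:
  fixes f :: "'a \<Rightarrow> real"
  assumes "finite A" "A \<noteq> {}"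
  obtains u where "u \<in> A" "\<And>a. a \<in> A \<Longrightarrow> f a \<le> f u"
proof -
  have "Max (f ` A) \<in> f ` A" using assms by (intro Max_in) auto
  then obtain u where "u \<in> A" "f u = Max (f ` A)" by auto
  then show thesis using assms that by simp
qed

lemma linear_pot_le_max:
  assumes "\<And>b. b \<in> V \<Longrightarrow> 0 \<le> w b"
    and "\<And>a. a \<in> V \<Longrightarrow> 0 < w a \<Longrightarrow> weight_deg V B w a \<le> s"
  shows "linear_pot V B w \<le> s * (\<Sum>a\<in>V. w a)"
  unfolding linear_pot_def sum_distrib_left
proof (rule sum_mono)
  fix a assume "a \<in> V"
  then show "w a * weight_deg V B w a \<le> s * w a"
    using assms[of a] by (cases "w a = 0") (auto simp: mult.commute)
qed

lemma square_pot_le_max: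
  assumes "\<And>b. b \<in> V \<Longrightarrow> 0 \<le> w b"
    and "\<And>a. a \<in> V \<Longrightarrow> 0 < w a \<Longrightarrow> weight_deg V B w a \<le> s"
  shows "square_pot V B w \<le> s * linear_pot V B w"
  unfolding linear_pot_def square_pot_def sum_distrib_left
proof (rule sum_mono)
  fix a assume a: "a \<in> V"
  let ?S = "weight_deg V B w a"
  have "0 \<le> ?S" using assms(1) by (rule weight_deg_nonneg)
  then show "w a * ?S\<^sup>2 \<le> s * (w a * ?S)"
    using assms[of a] a by (cases "w a = 0") (auto simp: power2_eq_square mult_right_mono mult.left_commute)
qed

text \<open>A single summand is already this large. Together with the quadratic bound in
  \<open>controlled\<close> this limits the weighted degree to an eighth of the total
  weight.\<close>

lemma weight_deg_squared_le:
  assumes "finite V" "a \<in> V" "1 \<le> w a" "\<And>b. b \<in> V \<Longrightarrow> 0 \<le> w b"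
  shows "(weight_deg V B w a)\<^sup>2 \<le> square_pot V B w"
proof -
  have "(weight_deg V B w a)\<^sup>2 \<le> w a * (weight_deg V B w a)\<^sup>2"
    using assms(3) by (simp add: mult_le_cancel_right1)
  also have "\<dots> \<le> square_pot V B w"
    unfolding square_pot_def using assms
    by (intro member_le_sum) auto
  finally show ?thesis .
qed

text \<open>\<open>A\<close> will be the set of candidates for \<open>v\<close>, where the maximum
  \<open>t\<close> applies; elsewhere only the overall maximum \<open>s\<close> is known.\<close>

lemma linear_pot_split:
  assumes "finite V" "A \<subseteq> V" and w: "\<And>b. b \<in> V \<Longrightarrow> 0 \<le> w b"
    and s: "\<And>a. a \<in> V \<Longrightarrow> 0 < w a \<Longrightarrow> weight_deg V B w a \<le> s"
    and t: "\<And>a. a \<in> A \<Longrightarrow> 0 < w a \<Longrightarrow> weight_deg V B w a \<le> t"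
  shows "linear_pot V B w \<le> t * (\<Sum>a\<in>A. w a) + s * (\<Sum>a\<in>V - A. w a)"
proof -
  have "linear_pot V B w = (\<Sum>a\<in>A. w a * weight_deg V B w a) + (\<Sum>a\<in>V - A. w a * weight_deg V B w a)"
    unfolding linear_pot_def using assms(1,2) by (metis add.commute sum.subset_diff)
  also have "\<dots> \<le> (\<Sum>a\<in>A. t * w a) + (\<Sum>a\<in>V - A. s * w a)"
  proof (intro add_mono sum_mono)
    fix a assume "a \<in> A"
    then show "w a * weight_deg V B w a \<le> t * w a"
      using t[of a] w[of a] assms(2) by (cases "w a = 0") (auto simp: mult.commute)
  next
    fix a assume "a \<in> V - A"
    then show "w a * weight_deg V B w a \<le> s * w a"
      using s[of a] w[of a] by (cases "w a = 0") (auto simp: mult.commute)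
  qed
  finally show ?thesis by (simp add: sum_distrib_left)
qed

section \<open>Inequalities for one round and Constructor's choice\<close>

text \<open>If \<open>s \<ge> c + k\<^sup>2\<close>, the choice of \<open>u\<close> alone decreases the linear potential \<open>L\<close> enough. Otherwise
  the vertices that are not available for \<open>v\<close> contribute only a bounded amount to \<open>L\<close>, which forces
  \<open>t > c - 1\<close>.\<close>

lemma linear_step_arith:
  fixes k c s t W L r :: real
  assumes c: "c = k\<^sup>2 + 2" and nonneg: "0 \<le> k" "0 \<le> s" "0 \<le> t" "0 \<le> r"
    and L: "L \<le> c * W" "L \<le> s * W" "L \<le> t * W + s * (r + s)"
    and W: "W \<ge> 2 * c + 2 * k\<^sup>2 + (c + k\<^sup>2) * (r + c + k\<^sup>2)"
  shows "L - 2 * s - 2 * t + 2 * k\<^sup>2 \<le> c * (W - 2)"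
proof (rule ccontr)
  assume "\<not> ?thesis"
  then have neg: "L - 2 * s - 2 * t + 2 * k\<^sup>2 > c * W - 2 * c"
    by (simp add: algebra_simps)
  have c2: "c \<ge> 2" using c by simp
  have s_less: "s < c + k\<^sup>2" using neg L(1) nonneg by linarith
  have L_gt: "L > c * W - (2 * c + 2 * k\<^sup>2)" using neg nonneg by linarith
  have prod: "s * (r + s) \<le> (c + k\<^sup>2) * (r + c + k\<^sup>2)"
    using s_less nonneg by (intro mult_mono) auto
  moreover have "0 \<le> (c + k\<^sup>2) * (r + c + k\<^sup>2)"
    using c2 nonneg by (intro mult_nonneg_nonneg) auto
  ultimately have Wpos: "W > 0" and bnd: "2 * c + 2 * k\<^sup>2 \<le> W" "2 * c + 2 * k\<^sup>2 + s * (r + s) \<le> W"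
    using W c2 by (smt (verit) zero_le_power2)+
  have "(c - 1) * W < s * W" using L(2) L_gt bnd(1) by (simp add: algebra_simps)
  then have s1: "s > c - 1" using Wpos by simp
  have "(c - 1) * W < t * W" using L(3) L_gt bnd(2) by (simp add: algebra_simps)
  then have "t > c - 1" using Wpos by simp
  \<comment> \<open>The value of \<open>c\<close> makes \<open>4 * (c - 1)\<close> equal to
    \<open>2 * c + 2 * k\<^sup>2\<close>, whereas \<open>neg\<close> and
    \<open>L \<le> c * W\<close> give \<open>2 * s + 2 * t < 2 * c + 2 * k\<^sup>2\<close>.\<close>
  with s1 neg L(1) c show False by linarith
qed

text \<open>When the quadratic potential \<open>Q\<close> is at least half of its allowed size, \<open>Q \<le> s L\<close> makes \<open>s\<close>
  linear in \<open>W\<close>, so the gain \<open>s\<^sup>2\<close> outweighs Blocker's reply and the decrease of \<open>W\<close>.\<close>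

lemma square_step_arith:
  fixes k c s W L Q :: real
  assumes nonneg: "1 \<le> k" "1 \<le> c" "0 \<le> s"
    and Q: "64 * Q \<le> W\<^sup>2" "s\<^sup>2 \<le> Q" "Q \<le> s * L" and L: "L \<le> c * W"
    and W: "W \<ge> 64 * k\<^sup>2 + 8 + 256 * k ^ 3"
      "W \<ge> 2 * c * (256 * k\<^sup>2 + 512 * c + 16384 * c * k ^ 3)"
  shows "64 * (Q - s\<^sup>2 + (4 * k\<^sup>2 * s + 2 * k ^ 3)) \<le> (W - 2)\<^sup>2"
proof -
  have k3: "1 \<le> k ^ 3" "1 \<le> k\<^sup>2" using nonneg by simp_all
  have Wpos: "W > 8" using W(1) k3 by linarith
  have "(8 * s)\<^sup>2 \<le> W\<^sup>2" using Q by (simp add: power_mult_distrib)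
  then have sW: "8 * s \<le> W" using power2_le_imp_le[of "8 * s" W] Wpos by linarith
  have expand: "(W - 2)\<^sup>2 = W\<^sup>2 - 4 * W + 4" by (simp add: power2_eq_square algebra_simps)
  show ?thesis
  proof (cases "128 * Q \<le> W\<^sup>2")
    \<comment> \<open>Half of \<open>W\<^sup>2\<close> is free here. Since
      \<open>s \<le> W / 8\<close>, it absorbs Blocker's gain and the term \<open>4 * W\<close> lost
      in passing to \<open>(W - 2)\<^sup>2\<close>.\<close>
    case True
    have "k\<^sup>2 * (8 * s) \<le> k\<^sup>2 * W" using sW k3 by (intro mult_left_mono) auto
    then have "8 * (k\<^sup>2 * s) \<le> k\<^sup>2 * W" by simp
    moreover have "(64 * k\<^sup>2 + 8 + 256 * k ^ 3) * W \<le> W * W"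
      using W Wpos by (intro mult_right_mono) auto
    then have "64 * (k\<^sup>2 * W) + 8 * W + 256 * (k ^ 3 * W) \<le> W\<^sup>2"
      by (simp add: power2_eq_square algebra_simps)
    moreover have "k ^ 3 * 1 \<le> k ^ 3 * W" using k3 Wpos nonneg(1) by (intro mult_left_mono) auto
    ultimately have "64 * Q - 64 * s\<^sup>2 + 256 * (k\<^sup>2 * s) + 128 * k ^ 3 \<le> W\<^sup>2 - 4 * W + 4"
      using True zero_le_power2[of s] by linarith
    then show ?thesis unfolding expand by (simp add: algebra_simps)
  next
    case False
    \<comment> \<open>Below, \<open>W \<le> 128 * c * s\<close> and the threshold
      \<open>2 * c * X \<le> W\<close> force \<open>X \<le> 64 * s\<close>, so
      \<open>64 * s\<^sup>2\<close> is at least \<open>s * X\<close>. The three summands of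
      \<open>X\<close> pay for the term linear in \<open>s\<close>, the loss \<open>4 * W\<close>
      and the constant \<open>128 * k ^ 3\<close>.\<close>
    define X where "X = 256 * k\<^sup>2 + 512 * c + 16384 * c * k ^ 3"
    have "s * L \<le> s * (c * W)" using L nonneg by (intro mult_left_mono)
    then have "128 * Q \<le> 128 * (s * (c * W))" using Q(3) by linarith
    with False have "W\<^sup>2 \<le> 128 * (s * (c * W))" by linarith
    then have "W * W \<le> (128 * c * s) * W" by (simp only: power2_eq_square mult_ac)
    then have sc: "W \<le> 128 * c * s" using Wpos by (simp only: mult_le_cancel_right)
    have "2 * c * X \<le> 128 * c * s"
      using sc W(2) unfolding X_def by linarith
    then have "c * X \<le> c * (64 * s)" by (simp add: algebra_simps)
    then have "X \<le> 64 * s"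
      using nonneg by simp
    then have "s * X \<le> s * (64 * s)"
      using nonneg by (intro mult_left_mono)
    then have "256 * (k\<^sup>2 * s) + 512 * (c * s) + 128 * (k ^ 3 * (128 * c * s)) \<le> 64 * s\<^sup>2"
      unfolding X_def by (simp add: power2_eq_square algebra_simps)
    moreover have "4 * W \<le> 512 * (c * s)" using sc by linarith
    moreover have "k ^ 3 * 1 \<le> k ^ 3 * (128 * c * s)"
      using sc Wpos k3 nonneg(1) by (intro mult_left_mono) auto
    ultimately show ?thesis using Q(1) unfolding expand by (simp add: algebra_simps)
  qed
qed

text \<open>A sum of separate lower bounds for the total weight: where it is used all summands are
  nonnegative, so each bound follows. The summand \<open>2 * r\<close> keeps candidates for
  \<open>v\<close> available; the others serve the two inequalities above.\<close>

definition step_threshold :: "real \<Rightarrow> real \<Rightarrow> real" where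
  "step_threshold k r = (let c = k\<^sup>2 + 2 in
     2 * r + 2 * c + 2 * k\<^sup>2 + (c + k\<^sup>2) * (r + c + k\<^sup>2)
     + 64 * k\<^sup>2 + 8 + 256 * k ^ 3 + 2 * c * (256 * k\<^sup>2 + 512 * c + 16384 * c * k ^ 3))"

text \<open>The linear bound supports the quadratic one, since the quadratic potential is at most
  the largest weighted degree times the linear potential. The factor 64 makes weighted degrees at
  most an eighth of the total weight.\<close>

definition controlled :: "'a set \<Rightarrow> 'a set set \<Rightarrow> real \<Rightarrow> ('a \<Rightarrow> real) \<Rightarrow> bool" where
  "controlled V B k w \<longleftrightarrow> linear_pot V B w \<le> (k\<^sup>2 + 2) * (\<Sum>a\<in>V. w a)
     \<and> 64 * square_pot V B w \<le> (\<Sum>a\<in>V. w a)\<^sup>2"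

text \<open>One round of play, in which the bounds survive any single edge of Blocker. Constructor's
  graph enters only through \<open>w\<close> and through the weight \<open>r\<close> of the vertices
  too close to be joined.\<close>

lemma controlled_step:
  fixes w :: "'a \<Rightarrow> real" and near :: "'a \<Rightarrow> 'a set"
  assumes V: "finite V" and k: "1 \<le> k"
    and w: "\<And>b. b \<in> V \<Longrightarrow> 0 \<le> w b" "\<And>b. b \<in> V \<Longrightarrow> w b \<le> k"
      "\<And>b. b \<in> V \<Longrightarrow> 0 < w b \<Longrightarrow> 1 \<le> w b"
    and near: "\<And>a. a \<in> near a" "\<And>a. (\<Sum>b\<in>V \<inter> near a. w b) \<le> r"
    and B: "\<And>a. {a} \<notin> B" and ctrl: "controlled V B k w"
    and large: "(\<Sum>a\<in>V. w a) > step_threshold k r"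
  obtains u v where "u \<in> V" "v \<in> V" "1 \<le> w u" "1 \<le> w v" "v \<notin> near u" "{u, v} \<notin> B"
    "\<And>x y B'. x \<in> V \<Longrightarrow> y \<in> V \<Longrightarrow> x \<noteq> y \<Longrightarrow> B' \<subseteq> insert {x, y} B \<Longrightarrow>
      controlled V B' k (drop_at u v w)"
proof -
  define W where "W = (\<Sum>a\<in>V. w a)"
  define c where "c = k\<^sup>2 + 2"
  let ?S = "weight_deg V B w"
  have r: "0 \<le> r"
    \<comment> \<open>Nonnegativity of \<open>r\<close> is read off at an arbitrary point.\<close>
    by (rule order_trans[OF _ near(2)[of undefined]]) (use w(1) in \<open>auto intro: sum_nonneg\<close>)
  have c2: "2 \<le> c" by (simp add: c_def)
  have terms: "0 \<le> (c + k\<^sup>2) * (r + c + k\<^sup>2)" "0 \<le> 2 * c * (256 * k\<^sup>2 + 512 * c + 16384 * c * k ^ 3)"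
    "0 \<le> k\<^sup>2" "0 \<le> k ^ 3"
    using r c2 k by (auto intro!: mult_nonneg_nonneg add_nonneg_nonneg)
  have "W > 2 * r + 2 * c + 2 * k\<^sup>2 + (c + k\<^sup>2) * (r + c + k\<^sup>2)
     + 64 * k\<^sup>2 + 8 + 256 * k ^ 3 + 2 * c * (256 * k\<^sup>2 + 512 * c + 16384 * c * k ^ 3)"
    using large by (simp add: step_threshold_def Let_def c_def W_def)
  then have W: "W > 2 * r" "W \<ge> 2 * c + 2 * k\<^sup>2 + (c + k\<^sup>2) * (r + c + k\<^sup>2)"
    "W \<ge> 64 * k\<^sup>2 + 8 + 256 * k ^ 3" "W \<ge> 2 * c * (256 * k\<^sup>2 + 512 * c + 16384 * c * k ^ 3)"
    using terms r c2 by linarith+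
  have Wpos: "W > 0" using W r by linarith
  have L: "linear_pot V B w \<le> c * W" and Q: "64 * square_pot V B w \<le> W\<^sup>2"
    using ctrl by (auto simp: controlled_def c_def W_def)
  define A where "A = {a \<in> V. 0 < w a}"
  have Wsum: "(\<Sum>a\<in>A. w a) = W"
    unfolding W_def A_def using V w(1) by (intro sum.mono_neutral_left) fastforce+
  then have "A \<noteq> {}" using Wpos by auto
  moreover have "finite A" using V by (simp add: A_def)
  ultimately obtain u where u: "u \<in> A" and u_max: "\<And>a. a \<in> A \<Longrightarrow> ?S a \<le> ?S u"
    using finite_argmax[of A ?S] by blast
  define s where "s = ?S u"
  have s: "0 \<le> s" unfolding s_def using w(1) by (rule weight_deg_nonneg)
  have s_max: "?S a \<le> s" if "a \<in> V" "0 < w a" for a using u_max that by (simp add: A_def s_def)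
  have uV: "u \<in> V" and wu: "1 \<le> w u" using u w(3) by (auto simp: A_def)
  have s_sq: "s\<^sup>2 \<le> square_pot V B w"
    unfolding s_def using V uV wu w(1) by (rule weight_deg_squared_le)
  then have "(8 * s)\<^sup>2 \<le> W\<^sup>2" using Q by (simp add: power_mult_distrib)
  then have sW: "8 * s \<le> W" using power2_le_imp_le[of "8 * s" W] Wpos by linarith
  \<comment> \<open>The candidates for \<open>v\<close>. All positive weight outside
    \<open>F\<close> lies near \<open>u\<close>, at most \<open>r\<close>, or on Blocker-neighbours
    of \<open>u\<close>, in total \<open>s\<close>.\<close>
  define F where "F = {a \<in> A. a \<notin> near u \<and> {u, a} \<notin> B}"
  have FV: "F \<subseteq> V" by (auto simp: F_def A_def)
  have rest: "(\<Sum>a\<in>V - F. w a) \<le> r + s"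
  proof -
    have "(\<Sum>a\<in>V - F. w a) \<le> (\<Sum>a\<in>V. (if a \<in> near u then w a else 0) + (if {u, a} \<in> B then w a else 0))"
    proof (rule sum_le_included[where i = id])
      show "\<forall>x\<in>V - F. \<exists>y\<in>V. id y = x \<and>
          w x \<le> (if y \<in> near u then w y else 0) + (if {u, y} \<in> B then w y else 0)"
        using w(1) by (fastforce simp: F_def A_def)
    qed (use V w(1) in auto)
    also have "\<dots> = (\<Sum>a\<in>V \<inter> near u. w a) + s"
      using V by (simp add: sum.distrib s_def weight_deg_def sum.inter_restrict)
    finally show ?thesis using near(2)[of u] by linarith
  qed
  have "(\<Sum>a\<in>F. w a) + (\<Sum>a\<in>V - F. w a) = W"
    unfolding W_def using V FV by (metis add.commute sum.subset_diff)
  moreover have "0 \<le> (\<Sum>a\<in>V - F. w a)" using w(1) by (auto intro: sum_nonneg)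
  \<comment> \<open>As \<open>r < W / 2\<close> and \<open>s \<le> W / 8\<close>, candidates of
    positive weight remain.\<close>
  ultimately have F: "(\<Sum>a\<in>F. w a) > 0" "(\<Sum>a\<in>F. w a) \<le> W"
    using rest W(1) sW Wpos r s by linarith+
  then have "F \<noteq> {}" by auto
  moreover have finF: "finite F" using V FV finite_subset by blast
  ultimately obtain v where v: "v \<in> F" and v_max: "\<And>a. a \<in> F \<Longrightarrow> ?S a \<le> ?S v"
    using finite_argmax[of F ?S] by blast
  define t where "t = ?S v"
  have t: "0 \<le> t" unfolding t_def using w(1) by (rule weight_deg_nonneg)
  have vV: "v \<in> V" and wv: "1 \<le> w v" and uv: "v \<notin> near u" "{u, v} \<notin> B"
    using v w(3) by (auto simp: F_def A_def)
  have uv_ne: "u \<noteq> v" using near(1) uv by auto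
  have L_s: "linear_pot V B w \<le> s * W"
    unfolding W_def using w(1) s_max by (rule linear_pot_le_max)
  have "linear_pot V B w \<le> t * (\<Sum>a\<in>F. w a) + s * (\<Sum>a\<in>V - F. w a)"
    using V FV w(1) s_max by (rule linear_pot_split) (use v_max t_def in auto)
  also have "\<dots> \<le> t * W + s * (r + s)"
    using F rest s t by (intro add_mono mult_left_mono)
  finally have L_t: "linear_pot V B w \<le> t * W + s * (r + s)" .
  have Q_s: "square_pot V B w \<le> s * linear_pot V B w"
    using w(1) s_max by (rule square_pot_le_max)
  let ?w = "drop_at u v w"
  have w': "0 \<le> ?w b" "?w b \<le> k" "?w b \<le> w b" if "b \<in> V" for b
    using w(1,2)[OF that] wu wv uv_ne by (auto simp: drop_at_def)
  have W': "(\<Sum>a\<in>V. ?w a) = W - 2"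
    using sum_drop_at[OF V uV vV, of w "\<lambda>_. 1"] by (simp add: W_def)
  show thesis
  proof
    fix x y B' assume xy: "x \<in> V" "y \<in> V" "x \<noteq> y" "B' \<subseteq> insert {x, y} B"
    have "linear_pot V B' ?w \<le> linear_pot V B ?w + 2 * k\<^sup>2"
      using V xy w'(1,2) by (rule linear_pot_insert_le)
    also have "\<dots> = linear_pot V B w - 2 * s - 2 * t + 2 * k\<^sup>2"
      using linear_pot_drop_at[OF V uV vV uv(2) B B] by (simp add: s_def t_def)
    also have "\<dots> \<le> c * (W - 2)"
      using linear_step_arith[OF c_def _ s t r L L_s L_t W(2)] k by simp
    finally have lin: "linear_pot V B' ?w \<le> c * (W - 2)" .
    have s_max': "weight_deg V B ?w a \<le> s" if "a \<in> V" "0 < ?w a" for a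
    proof -
      have "weight_deg V B ?w a \<le> ?S a"
        using w'(1,3) by (intro weight_deg_mono) auto
      also have "\<dots> \<le> s" using that w'(3) by (intro s_max) force+
      finally show ?thesis .
    qed
    have "square_pot V B' ?w \<le> square_pot V B ?w + 4 * k\<^sup>2 * s + 2 * k ^ 3"
      using V xy w'(1,2) s_max' s by (rule square_pot_insert_le)
    also have "square_pot V B ?w \<le> square_pot V B w - s\<^sup>2"
      unfolding s_def using V uV vV w(1) w'(1) by (rule square_pot_drop_at_le)
    finally have "64 * square_pot V B' ?w \<le> 64 * (square_pot V B w - s\<^sup>2 + (4 * k\<^sup>2 * s + 2 * k ^ 3))"
      by simp
    also have "64 * (square_pot V B w - s\<^sup>2 + (4 * k\<^sup>2 * s + 2 * k ^ 3)) \<le> (W - 2)\<^sup>2"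
      using square_step_arith[OF k _ s Q s_sq Q_s L W(3,4)] c2 by simp
    finally have "64 * square_pot V B' ?w \<le> (W - 2)\<^sup>2" .
    with lin show "controlled V B' k ?w"
      by (simp add: controlled_def c_def W')
  qed (use uV vV wu wv uv in auto)
qed


section \<open>Stars, balls and short cycles\<close>

text \<open>Copies need not be induced, so a star is merely a vertex with enough neighbours and
  avoiding it is a degree bound.\<close>

lemma contains_star_iff:
  assumes G: "fin_graph G" and m: "m \<ge> 1"
  shows "contains_copy (star m) G \<longleftrightarrow> (\<exists>v \<in> verts G. m \<le> card (nbrs (edges G) v))"
proof
  have finG: "finite (verts G)" and EG: "edges G \<subseteq> all_edges (verts G)"
    using G by (auto simp: fin_graph_def)
  show "\<exists>v \<in> verts G. m \<le> card (nbrs (edges G) v)" if star: "contains_copy (star m) G"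
  proof -
    obtain K where "K \<in> copies (star m) G"
      using star unfolding contains_copy_def by blast
    then have K: "subgraph K G" "isomorphic (star m) K" by (simp_all add: copies_def)
    then obtain f where f: "bij_betw f {0..m} (verts K)"
      "edges K = (\<lambda>e. f ` e) ` {{0, i} | i. i \<in> {1..m}}"
      by (auto simp: isomorphic_def star_def)
    have inj: "inj_on f {0..m}" using f(1) by (rule bij_betw_imp_inj_on)
    have "f ` {1..m} \<subseteq> nbrs (edges G) (f 0)"
    proof safe
      fix i assume "i \<in> {1..m}"
      then have "f ` {0, i} \<in> edges K" unfolding f(2) by blast
      then show "f i \<in> nbrs (edges G) (f 0)" using K(1) by (auto simp: subgraph_def)
    qed
    then have "card (f ` {1..m}) \<le> card (nbrs (edges G) (f 0))"
      by (intro card_mono finite_nbrs[OF finG EG])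
    moreover have "card (f ` {1..m}) = m"
      using card_image[OF inj_on_subset[OF inj, of "{1..m}"]] by simp
    moreover have "f 0 \<in> verts G"
      using bij_betw_apply[OF f(1), of 0] K(1) by (auto simp: subgraph_def)
    ultimately show ?thesis by auto
  qed
  show "contains_copy (star m) G" if large: "\<exists>v \<in> verts G. m \<le> card (nbrs (edges G) v)"
  proof -
    obtain v where v: "v \<in> verts G" "m \<le> card (nbrs (edges G) v)" using large by blast
    then obtain X where X: "X \<subseteq> nbrs (edges G) v" "card X = m" "finite X"
      by (meson obtain_subset_with_card_n)
    then obtain g where g: "bij_betw g {1..m} X"
      using ex_bij_betw_nat_finite_1 by blast
    let ?f = "\<lambda>i\<in>{0..m}. if i = 0 then v else g i"
    have gX: "g i \<in> X" if "i \<in> {1..m}" for i using g that by (auto dest: bij_betwE)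
    have vX: "v \<notin> X" using subsetD[OF X(1), of v] EG all_edgesD(3)[of v v "verts G"] by auto
    have XG: "X \<subseteq> verts G" using X(1) nbrs_subset[OF EG] by (rule subset_trans)
    have "inj_on ?f {0..m}"
    proof (rule inj_onI)
      fix i j assume ij: "i \<in> {0..m}" "j \<in> {0..m}" "?f i = ?f j"
      have "g i \<noteq> v" if "i \<in> {1..m}" for i using gX[OF that] vX by blast
      then show "i = j"
        using ij inj_onD[OF bij_betw_imp_inj_on[OF g], of i j]
        by (cases "i = 0"; cases "j = 0") (force simp: Suc_le_eq)+
    qed
    moreover have "?f ` {0, i} \<in> edges G" if "i \<in> {1..m}" for i
      using subsetD[OF X(1) gX[OF that]] that by (auto simp: insert_commute)
    moreover have "?f \<in> {0..m} \<rightarrow>\<^sub>E verts G" using gX XG v(1) by fastforce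
    ultimately have "?f \<in> inj_homs (star m) G"
      by (auto simp: inj_homs_def star_def simp del: restrict_apply)
    moreover have "fin_graph (star m)"
      by (auto simp: fin_graph_def star_def all_edges_def card_insert_if)
    ultimately have "image_graph ?f (star m) \<in> copies (star m) G"
      using image_graph_in_copies G by blast
    then show ?thesis by (auto simp: contains_copy_def)
  qed
qed

section \<open>Balls of bounded radius and edges between distant vertices\<close>

definition near :: "nat \<Rightarrow> 'a set set \<Rightarrow> 'a \<Rightarrow> 'a set" where
  "near L E x = {y. \<exists>j \<le> L. (x, y) \<in> adj E ^^ j}"

lemma near_sym: "y \<in> near L E x \<Longrightarrow> x \<in> near L E y"
  by (auto simp: near_def dest: relpow_adj_sym)

lemma walk_in_verts:
  assumes "E \<subseteq> all_edges V" "x \<in> V" "(x, y) \<in> adj E ^^ j"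
  shows "y \<in> V"
proof (cases j)
  case (Suc i)
  then obtain z where "{z, y} \<in> E" using assms(3) by auto
  then show ?thesis using assms(1) all_edgesD(2)[of z y V] by auto
qed (use assms in auto)

text \<open>An extra step replaces each vertex by itself and at most \<open>k\<close> neighbours,
  hence the factor \<open>k + 1\<close>.\<close>

lemma card_near:
  assumes V: "finite V" and E: "E \<subseteq> all_edges V" and deg: "\<And>y. y \<in> V \<Longrightarrow> card (nbrs E y) \<le> k"
    and x: "x \<in> V"
  shows "finite (near L E x) \<and> card (near L E x) \<le> (k + 1) ^ L"
proof (induction L)
  case 0
  then show ?case by (simp add: near_def)
next
  case (Suc L)
  have nearV: "near L E x \<subseteq> V" using walk_in_verts[OF E x] by (auto simp: near_def)
  let ?U = "\<Union>y \<in> near L E x. insert y (nbrs E y)"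
  have sub: "near (Suc L) E x \<subseteq> ?U"
  proof
    fix z assume "z \<in> near (Suc L) E x"
    then obtain j where j: "j \<le> Suc L" "(x, z) \<in> adj E ^^ j" by (auto simp: near_def)
    show "z \<in> ?U"
    proof (cases j)
      case 0
      then show ?thesis using j by (auto simp: near_def intro!: exI[of _ "0::nat"])
    next
      case (Suc i)
      then obtain y where "(x, y) \<in> adj E ^^ i" "{y, z} \<in> E" using j by auto
      then show ?thesis using Suc j by (auto simp: near_def)
    qed
  qed
  have finU: "finite ?U" using Suc.IH finite_nbrs[OF V E] by auto
  have "card ?U \<le> (\<Sum>y \<in> near L E x. card (insert y (nbrs E y)))"
    using Suc.IH by (intro card_UN_le) auto
  also have "\<dots> \<le> (\<Sum>y \<in> near L E x. k + 1)"
  proof (rule sum_mono)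
    fix y assume "y \<in> near L E x"
    then have "card (nbrs E y) \<le> k" using deg nearV by blast
    then show "card (insert y (nbrs E y)) \<le> k + 1"
      using finite_nbrs[OF V E, of y] by (simp add: card_insert_if)
  qed
  also have "\<dots> \<le> (k + 1) ^ L * (k + 1)"
    using Suc.IH mult_le_mono1[of "card (near L E x)" "(k + 1) ^ L" "k + 1"] by simp
  finally have "card ?U \<le> (k + 1) ^ Suc L" by (simp add: mult.commute)
  then show ?case
    using card_mono[OF finU sub] finite_subset[OF sub finU] by linarith
qed

text \<open>A walk can be shortened until it crosses the new edge at most once, in one of the two
  directions.\<close>

lemma walk_insert_edge:
  assumes "(x, y) \<in> adj (insert {u, v} A) ^^ j"
  shows "(\<exists>i \<le> j. (x, y) \<in> adj A ^^ i) \<or>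
    (\<exists>a b. a + b + 1 \<le> j \<and> ((x, u) \<in> adj A ^^ a \<and> (v, y) \<in> adj A ^^ b
      \<or> (x, v) \<in> adj A ^^ a \<and> (u, y) \<in> adj A ^^ b))"
  using assms
proof (induction j arbitrary: y)
  case 0
  then show ?case by auto
next
  case (Suc j)
  then obtain z where z: "(x, z) \<in> adj (insert {u, v} A) ^^ j" and zy: "{z, y} \<in> insert {u, v} A"
    by auto
  note IH = Suc.IH[OF z]
  show ?case
  proof (cases "{z, y} \<in> A")
    case True
    then have ext: "(c, y) \<in> adj A ^^ Suc i" if "(c, z) \<in> adj A ^^ i" for c i
      using that by auto
    from IH show ?thesis
    proof (elim disjE exE conjE)
      fix i assume "i \<le> j" "(x, z) \<in> adj A ^^ i"
      then show ?thesis using ext by (metis Suc_le_mono)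
    next
      fix a b assume "a + b + 1 \<le> j" "(x, u) \<in> adj A ^^ a" "(v, z) \<in> adj A ^^ b"
      then have "a + Suc b + 1 \<le> Suc j" "(x, u) \<in> adj A ^^ a" "(v, y) \<in> adj A ^^ Suc b"
        using ext by (simp, blast+)
      then show ?thesis by blast
    next
      fix a b assume "a + b + 1 \<le> j" "(x, v) \<in> adj A ^^ a" "(u, z) \<in> adj A ^^ b"
      then have "a + Suc b + 1 \<le> Suc j" "(x, v) \<in> adj A ^^ a" "(u, y) \<in> adj A ^^ Suc b"
        using ext by (simp, blast+)
      then show ?thesis by blast
    qed
  next
    case False
    then have "z = u \<and> y = v \<or> z = v \<and> y = u" using zy by (auto simp: doubleton_eq_iff)
    moreover have refl: "(c, c) \<in> adj A ^^ 0" for c by simp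
    ultimately show ?thesis using IH
    proof (elim disjE exE conjE)
      fix i assume "z = u" "y = v" "i \<le> j" "(x, z) \<in> adj A ^^ i"
      then have "i + 0 + 1 \<le> Suc j" "(x, u) \<in> adj A ^^ i" "(v, y) \<in> adj A ^^ 0" by auto
      then show ?thesis by blast
    next
      fix i assume "z = v" "y = u" "i \<le> j" "(x, z) \<in> adj A ^^ i"
      then have "i + 0 + 1 \<le> Suc j" "(x, v) \<in> adj A ^^ i" "(u, y) \<in> adj A ^^ 0" by auto
      then show ?thesis by blast
    next
      fix a b assume "z = u" "y = v" "a + b + 1 \<le> j" "(x, u) \<in> adj A ^^ a"
      then have "a + 0 + 1 \<le> Suc j" "(x, u) \<in> adj A ^^ a" "(v, y) \<in> adj A ^^ 0" by auto
      then show ?thesis by blast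
    next
      \<comment> \<open>The second crossing returns to an end that was already reached, so the
        detour is dropped.\<close>
      fix a b assume "z = u" "y = v" "a + b + 1 \<le> j" "(x, v) \<in> adj A ^^ a"
      then have "a \<le> Suc j" "(x, y) \<in> adj A ^^ a" by auto
      then show ?thesis by blast
    next
      fix a b assume "z = v" "y = u" "a + b + 1 \<le> j" "(x, u) \<in> adj A ^^ a"
      then have "a \<le> Suc j" "(x, y) \<in> adj A ^^ a" by auto
      then show ?thesis by blast
    next
      fix a b assume "z = v" "y = u" "a + b + 1 \<le> j" "(x, v) \<in> adj A ^^ a"
      then have "a + 0 + 1 \<le> Suc j" "(x, v) \<in> adj A ^^ a" "(u, y) \<in> adj A ^^ 0" by auto
      then show ?thesis by blast
    qed
  qed
qed

text \<open>A new short cycle uses the new edge. The rest of the cycle yields a walk of length at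
  most \<open>L\<close> between \<open>u\<close> and \<open>v\<close> in \<open>C\<close>, which
  \<open>far\<close> excludes.\<close>

lemma no_short_cycle_insert:
  assumes "no_short_cycle L C" and far: "v \<notin> near L C u"
  shows "no_short_cycle L (insert {u, v} C)"
  unfolding no_short_cycle_def
proof (intro allI impI notI)
  fix x y j
  assume xy: "{x, y} \<in> insert {u, v} C" and j: "j \<le> L"
    and walk: "(x, y) \<in> adj (insert {u, v} C - {{x, y}}) ^^ j"
  have far': "(u, v) \<notin> adj C ^^ i" if "i \<le> L" for i using far that by (auto simp: near_def)
  show False
  proof (cases "{x, y} = {u, v}")
    case True
    then have "(x, y) \<in> adj C ^^ j" using walk by (intro relpow_adj_mono[OF _ walk]) auto
    then show False using True far'[OF j] relpow_adj_sym by (metis doubleton_eq_iff)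
  next
    case False
    then have xyC: "{x, y} \<in> C" using xy by blast
    let ?A = "C - {{x, y}}"
    have lift: "(c, d) \<in> adj C ^^ i" if "(c, d) \<in> adj ?A ^^ i" for c d i
      by (rule relpow_adj_mono[OF _ that]) auto
    have close: False if "a + b + 1 \<le> j" "(x, c) \<in> adj ?A ^^ a" "(d, y) \<in> adj ?A ^^ b"
      "{c, d} = {u, v}" for a b c d
    proof -
      have "(c, x) \<in> adj C ^^ a" "(y, d) \<in> adj C ^^ b"
        using that lift relpow_adj_sym by metis+
      moreover have "(x, y) \<in> adj C" using xyC by simp
      ultimately have "(c, d) \<in> adj C ^^ (Suc a + b)"
        by (meson relcompI relpow_Suc_I relpow_add[THEN equalityD2, THEN subsetD])
      moreover have "Suc a + b \<le> L" using that j by simp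
      ultimately show False using far' that(4) relpow_adj_sym by (metis doubleton_eq_iff)
    qed
    have "insert {u, v} C - {{x, y}} = insert {u, v} ?A" using False by auto
    then have "(x, y) \<in> adj (insert {u, v} ?A) ^^ j" using walk by simp
    from walk_insert_edge[OF this] show False
    proof (elim disjE exE conjE)
      fix i assume "i \<le> j" "(x, y) \<in> adj ?A ^^ i"
      then show False using assms(1) xyC j unfolding no_short_cycle_def by (meson order_trans)
    qed (use close[of _ _ u v] close[of _ _ v u] in \<open>auto simp: insert_commute\<close>)
  qed
qed


section \<open>Constructor's strategy\<close>

definition deficit :: "nat \<Rightarrow> 'a set set \<Rightarrow> 'a \<Rightarrow> real" where
  "deficit k C a = real k - real (card (nbrs C a))"

lemma deficit_insert:
  assumes "finite V" "C \<subseteq> all_edges V" "u \<noteq> v" "{u, v} \<notin> C"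
  shows "deficit k (insert {u, v} C) = drop_at u v (deficit k C)"
proof
  fix a
  have fin: "finite (nbrs C a)" using finite_nbrs[OF assms(1,2)] .
  have "nbrs (insert {u, v} C) a
      = nbrs C a \<union> (if a = u then {v} else if a = v then {u} else {})"
    using assms(3) by (auto simp: doubleton_eq_iff)
  then show "deficit k (insert {u, v} C) a = drop_at u v (deficit k C) a"
    using fin assms(3,4) by (auto simp: deficit_def drop_at_def insert_commute)
qed

definition strategy_inv :: "'a set \<Rightarrow> nat \<Rightarrow> nat \<Rightarrow> 'a set set \<Rightarrow> 'a set set \<Rightarrow> bool" where
  "strategy_inv V k L C B \<longleftrightarrow> C \<subseteq> all_edges V \<and> B \<subseteq> all_edges V \<and>
    (\<forall>v \<in> V. card (nbrs C v) \<le> k) \<and> no_short_cycle L C \<and> controlled V B k (deficit k C)"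

text \<open>A ball of radius \<open>L\<close> has at most \<open>(k + 1) ^ L\<close> vertices, each
  of deficit at most \<open>k\<close>; this is the value of \<open>r\<close> in
  \<open>controlled_step\<close>.\<close>

definition deficit_bound :: "nat \<Rightarrow> nat \<Rightarrow> real" where
  "deficit_bound k L = step_threshold k (real k * real ((k + 1) ^ L))"

lemma strategy_step:
  assumes V: "finite V" and k: "k \<ge> 1" and L: "L \<ge> 1" and inv: "strategy_inv V k L C B"
    and large: "(\<Sum>a\<in>V. deficit k C a) > deficit_bound k L"
  obtains e where "e \<in> all_edges V" "e \<notin> C" "e \<notin> B" "strategy_inv V k L (insert e C) B"
    "\<And>f. f \<in> all_edges V \<Longrightarrow> strategy_inv V k L (insert e C) (insert f B)"
proof -
  have C: "C \<subseteq> all_edges V" and B: "B \<subseteq> all_edges V" and short: "no_short_cycle L C"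
    and deg: "\<And>v. v \<in> V \<Longrightarrow> card (nbrs C v) \<le> k" and ctrl: "controlled V B k (deficit k C)"
    using inv by (auto simp: strategy_inv_def)
  \<comment> \<open>Outside \<open>V\<close> a singleton replaces the ball, since the size of balls
    is bounded for vertices of \<open>V\<close> only, while \<open>controlled_step\<close> ranges
    over all points.\<close>
  let ?near = "\<lambda>a. if a \<in> V then near L C a else {a}"
  have sum_near: "(\<Sum>b\<in>V \<inter> ?near a. deficit k C b) \<le> real k * real ((k + 1) ^ L)" for a
  proof (cases "a \<in> V")
    case True
    have "(\<Sum>b\<in>V \<inter> ?near a. deficit k C b) \<le> real (card (V \<inter> ?near a)) * real k"
      by (intro sum_bounded_above) (simp add: deficit_def)
    also have "\<dots> \<le> real ((k + 1) ^ L) * real k"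
    proof (intro mult_right_mono)
      have "card (V \<inter> ?near a) \<le> card (near L C a)"
        using card_near[OF V C deg True] True by (intro card_mono) auto
      also have "\<dots> \<le> (k + 1) ^ L" using card_near[OF V C deg True] by blast
      finally show "real (card (V \<inter> ?near a)) \<le> real ((k + 1) ^ L)" by (rule of_nat_mono)
    qed simp
    finally show ?thesis by (simp add: mult.commute)
  qed simp
  have single: "{a} \<notin> B" for a using B all_edgesD(3)[of a a V] by auto
  obtain u v where uv: "u \<in> V" "v \<in> V" "1 \<le> deficit k C u" "1 \<le> deficit k C v"
      "v \<notin> ?near u" "{u, v} \<notin> B"
    and next_ctrl: "\<And>x y B'. x \<in> V \<Longrightarrow> y \<in> V \<Longrightarrow> x \<noteq> y \<Longrightarrow> B' \<subseteq> insert {x, y} B \<Longrightarrow>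
      controlled V B' k (drop_at u v (deficit k C))"
  proof (rule controlled_step[of V "real k" "deficit k C" ?near "real k * real ((k + 1) ^ L)" B])
    show "\<And>b. b \<in> V \<Longrightarrow> 0 \<le> deficit k C b" "\<And>b. b \<in> V \<Longrightarrow> 0 < deficit k C b \<Longrightarrow> 1 \<le> deficit k C b"
      using deg by (force simp: deficit_def)+
    show "\<And>a. a \<in> ?near a" by (auto simp: near_def intro: exI[of _ "0::nat"])
  qed (use V k sum_near single ctrl large in \<open>auto simp: deficit_def deficit_bound_def\<close>)
  have far: "v \<notin> near L C u" using uv by simp
  then have ne: "u \<noteq> v" by (auto simp: near_def)
  \<comment> \<open>With \<open>L \<ge> 1\<close> the neighbours in \<open>C\<close> count as near,
    so Constructor does not yet own the chosen edge.\<close>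
  have new: "{u, v} \<notin> C" using far L by (auto simp: near_def dest!: spec[of _ "1::nat"])
  define C' where "C' = insert {u, v} C"
  have C': "C' \<subseteq> all_edges V" using C uv ne by (auto simp: C'_def intro: all_edgesI)
  have def': "deficit k C' = drop_at u v (deficit k C)"
    unfolding C'_def using V C ne new by (rule deficit_insert)
  have deg': "card (nbrs C' a) \<le> k" if "a \<in> V" for a
  proof -
    have "0 \<le> deficit k C' a"
      unfolding def' drop_at_def using uv(3,4) ne deg[OF that] by (auto simp: deficit_def)
    then show ?thesis by (simp add: deficit_def)
  qed
  have short': "no_short_cycle L C'" unfolding C'_def using short far by (rule no_short_cycle_insert)
  have inv': "strategy_inv V k L C' (insert f B)" if f: "f \<in> all_edges V" for f
  proof -
    obtain x y where "f = {x, y}" "x \<in> V" "y \<in> V" "x \<noteq> y" using f by (rule all_edgesE)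
    then have "controlled V (insert f B) k (deficit k C')"
      unfolding def' using next_ctrl by blast
    then show ?thesis using C' B f deg' short' by (auto simp: strategy_inv_def)
  qed
  have uv_edge: "{u, v} \<in> all_edges V" using uv ne by (intro all_edgesI)
  have "strategy_inv V k L C' B"
  proof -
    \<comment> \<open>The case \<open>B' = B\<close>, before Blocker replies; the pair
      \<open>u\<close>, \<open>v\<close> stands in for Blocker's edge.\<close>
    have "controlled V B k (deficit k C')"
      unfolding def' using uv ne next_ctrl[of u v B] by blast
    then show ?thesis using C' B deg' short' by (auto simp: strategy_inv_def)
  qed
  then show thesis using that[of "{u, v}"] uv_edge new uv(6) inv' by (simp add: C'_def)
qed


section \<open>The value of the game\<close>

lemma copies_mono:
  fixes n :: nat
  assumes "C \<subseteq> C'" "C' \<subseteq> all_edges {..<n}"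
  shows "copies H ({..<n}, C) \<subseteq> copies H ({..<n}, C')"
  using assms by (auto simp: copies_def subgraph_def fin_graph_def)

lemma card_copies_mono:
  fixes n :: nat
  assumes "C \<subseteq> C'" "C' \<subseteq> all_edges {..<n}"
  shows "card (copies H ({..<n}, C)) \<le> card (copies H ({..<n}, C'))"
  using assms by (intro card_mono copies_mono finite_copies) (auto simp: fin_graph_def)

lemma constructor_moves_subset: "constructor_moves n F C B \<subseteq> unclaimed n C B"
  by (auto simp: constructor_moves_def)

lemma finite_constructor_moves: "finite (constructor_moves n F C B)"
  using constructor_moves_subset finite_unclaimed by (rule finite_subset)

lemma unclaimed_in_all_edges: "e \<in> unclaimed n C B \<Longrightarrow> e \<in> all_edges {..<n}"
  by (simp add: unclaimed_def)

section \<open>Unfolding optimal play\<close>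

lemma game_value_end:
  "constructor_moves n F C B = {} \<Longrightarrow> game_value n H F p C B = card (copies H ({..<n}, C))"
  by (subst game_value.simps) simp

lemma game_value_Constructor:
  "constructor_moves n F C B \<noteq> {} \<Longrightarrow> game_value n H F Constructor C B =
    Max ((\<lambda>e. game_value n H F Blocker (insert e C) B) ` constructor_moves n F C B)"
  by (subst game_value.simps) simp

lemma game_value_Blocker:
  "constructor_moves n F C B \<noteq> {} \<Longrightarrow> game_value n H F Blocker C B =
    Min ((\<lambda>e. game_value n H F Constructor C (insert e B)) ` unclaimed n C B)"
  by (subst game_value.simps) simp

lemma game_value_Constructor_ge:
  assumes "e \<in> constructor_moves n F C B"
  shows "game_value n H F Blocker (insert e C) B \<le> game_value n H F Constructor C B"
proof -
  have ne: "constructor_moves n F C B \<noteq> {}" using assms by blast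
  show ?thesis
    unfolding game_value_Constructor[OF ne] using assms finite_constructor_moves[of n F C B]
    by (intro Max_ge) auto
qed

lemma game_value_attained:
  assumes "constructor_moves n F C B \<noteq> {}"
  shows "\<exists>e \<in> constructor_moves n F C B.
      game_value n H F Constructor C B = game_value n H F Blocker (insert e C) B"
    and "\<exists>e \<in> unclaimed n C B.
      game_value n H F Blocker C B = game_value n H F Constructor C (insert e B)"
proof -
  have "game_value n H F Constructor C B
      \<in> (\<lambda>e. game_value n H F Blocker (insert e C) B) ` constructor_moves n F C B"
    unfolding game_value_Constructor[OF assms] using assms finite_constructor_moves[of n F C B]
    by (intro Max_in) auto
  then show "\<exists>e \<in> constructor_moves n F C B.
      game_value n H F Constructor C B = game_value n H F Blocker (insert e C) B" by auto
  have "game_value n H F Blocker C B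
      \<in> (\<lambda>e. game_value n H F Constructor C (insert e B)) ` unclaimed n C B"
    unfolding game_value_Blocker[OF assms]
    using assms finite_unclaimed[of n C B] constructor_moves_subset[of n F C B] by (intro Min_in) auto
  then show "\<exists>e \<in> unclaimed n C B.
      game_value n H F Blocker C B = game_value n H F Constructor C (insert e B)" by auto
qed

text \<open>Optimal play ends in an \<open>F\<close>-free graph that extends \<open>C\<close>. From
  the empty position this bounds the score by the extremal number; later it shows that copies
  already built are kept.\<close>

lemma game_value_final_graph:
  assumes "C \<subseteq> all_edges {..<n}" "\<not> contains_copy F ({..<n}, C)"
  shows "\<exists>C'. C \<subseteq> C' \<and> C' \<subseteq> all_edges {..<n} \<and> \<not> contains_copy F ({..<n}, C') \<and>
    game_value n H F p C B = card (copies H ({..<n}, C'))"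
  using assms
proof (induction "card (unclaimed n C B)" arbitrary: p C B rule: less_induct)
  case less
  show ?case
  proof (cases "constructor_moves n F C B = {}")
    case True
    then show ?thesis using less.prems by (intro exI[of _ C]) (simp add: game_value_end)
  next
    case False
    show ?thesis
    proof (cases p)
      case Constructor
      obtain e where e: "e \<in> constructor_moves n F C B"
        "game_value n H F Constructor C B = game_value n H F Blocker (insert e C) B"
        using game_value_attained(1)[OF False] by blast
      then have un: "e \<in> unclaimed n C B" and free: "\<not> contains_copy F ({..<n}, insert e C)"
        by (auto simp: constructor_moves_def)
      have "insert e C \<subseteq> all_edges {..<n}"
        using less.prems(1) unclaimed_in_all_edges[OF un] by simp
      from less.hyps[OF card_unclaimed_less(1)[OF un] this free, of Blocker]
      show ?thesis using e(2) Constructor by auto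
    next
      case Blocker
      obtain f where f: "f \<in> unclaimed n C B"
        "game_value n H F Blocker C B = game_value n H F Constructor C (insert f B)"
        using game_value_attained(2)[OF False] by blast
      from less.hyps[OF card_unclaimed_less(2)[OF f(1)] less.prems, of Constructor]
      show ?thesis using f(2) Blocker by simp
    qed
  qed
qed

text \<open>The strategy is followed while the total deficit exceeds the bound, by induction on the
  number of unclaimed edges. At a turn of Blocker the invariant must survive every reply, hence the
  conditional premise.\<close>

lemma game_value_strategy:
  fixes X :: real
  assumes k: "k \<ge> 1" and L: "L \<ge> 1"
    and goal: "\<And>C B. strategy_inv {..<n} k L C B \<Longrightarrow> (\<Sum>a<n. deficit k C a) \<le> deficit_bound k L \<Longrightarrow>
      X \<le> real (card (copies H ({..<n}, C)))"
    and inv: "strategy_inv {..<n} k L C B"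
      "p = Blocker \<Longrightarrow> (\<And>f. f \<in> all_edges {..<n} \<Longrightarrow> strategy_inv {..<n} k L C (insert f B))"
  shows "X \<le> real (game_value n H (star (k + 1)) p C B)"
  using inv
proof (induction "card (unclaimed n C B)" arbitrary: p C B rule: less_induct)
  case less
  let ?F = "star (k + 1)"
  have free: "\<not> contains_copy ?F ({..<n}, C)" if "strategy_inv {..<n} k L C B" for C B
  proof -
    have "fin_graph ({..<n}, C)" "\<forall>v<n. card (nbrs C v) \<le> k"
      using that by (auto simp: strategy_inv_def fin_graph_def)
    then show ?thesis by (subst contains_star_iff) (auto simp: not_le less_Suc_eq_le)
  qed
  show ?case
  proof (cases "(\<Sum>a<n. deficit k C a) \<le> deficit_bound k L")
    case True
    \<comment> \<open>From here on any continuation is good enough: Constructor's graph only grows,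
      and no copy is lost.\<close>
    have "C \<subseteq> all_edges {..<n}" using less.prems by (simp add: strategy_inv_def)
    from game_value_final_graph[OF this free[OF less.prems(1)], where H = H and p = p and B = B]
    obtain C' where "C \<subseteq> C'" "C' \<subseteq> all_edges {..<n}"
      "game_value n H ?F p C B = card (copies H ({..<n}, C'))"
      by (elim exE conjE)
    then show ?thesis
      using goal[OF less.prems(1) True] card_copies_mono[of C C' n H] by linarith
  next
    case False
    then obtain e where e: "e \<in> all_edges {..<n}" "e \<notin> C" "e \<notin> B"
      and inv: "strategy_inv {..<n} k L (insert e C) B"
        "\<And>f. f \<in> all_edges {..<n} \<Longrightarrow> strategy_inv {..<n} k L (insert e C) (insert f B)"
      using strategy_step[OF finite_lessThan k L less.prems(1)] by (metis not_le)
    have un: "e \<in> unclaimed n C B" using e by (simp add: unclaimed_def)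
    then have move: "e \<in> constructor_moves n ?F C B"
      using free[OF inv(1)] by (simp add: constructor_moves_def)
    show ?thesis
    proof (cases p)
      case Constructor
      have "X \<le> real (game_value n H ?F Blocker (insert e C) B)"
        using card_unclaimed_less(1)[OF un] inv by (rule less.hyps)
      also have "\<dots> \<le> real (game_value n H ?F Constructor C B)"
        using game_value_Constructor_ge[OF move] by simp
      finally show ?thesis by (simp add: Constructor)
    next
      case Blocker
      \<comment> \<open>Constructor's possible edge \<open>e\<close> shows that the game is not
        over, so the value is a minimum attained by some edge of Blocker.\<close>
      obtain f where f: "f \<in> unclaimed n C B"
        "game_value n H ?F Blocker C B = game_value n H ?F Constructor C (insert f B)"
        using game_value_attained(2) move by blast
      have "strategy_inv {..<n} k L C (insert f B)"
        using less.prems(2) Blocker f(1) unclaimed_in_all_edges by blast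
      from less.hyps[OF card_unclaimed_less(2)[OF f(1)] this, of Constructor]
      have "X \<le> real (game_value n H ?F Constructor C (insert f B))" by simp
      then show ?thesis using f(2) Blocker by simp
    qed
  qed
qed

section \<open>The extremal number and the final comparison\<close>

lemma ex_num_attained:
  assumes "\<not> contains_copy F ({..<n}, {} :: nat set set)"
  obtains C where "C \<subseteq> all_edges {..<n}" "\<not> contains_copy F ({..<n}, C)"
      "ex_num n H F = card (copies H ({..<n}, C))"
    and "\<And>C. C \<subseteq> all_edges {..<n} \<Longrightarrow> \<not> contains_copy F ({..<n}, C) \<Longrightarrow>
      card (copies H ({..<n}, C)) \<le> ex_num n H F"
proof -
  let ?A = "{C. C \<subseteq> all_edges {..<n} \<and> \<not> contains_copy F ({..<n}, C)}"
  let ?f = "\<lambda>C. card (copies H ({..<n}, C))"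
  have "{card (copies H G) | G :: nat graph. fin_graph G \<and> verts G = {..<n} \<and> \<not> contains_copy F G}
      = ?f ` ?A"
    by (force simp: fin_graph_def)
  then have ex: "ex_num n H F = Max (?f ` ?A)" by (simp add: ex_num_def)
  have "finite ?A" using finite_all_edges[of "{..<n}"] by simp
  moreover have "{} \<in> ?A" using assms by simp
  ultimately have "ex_num n H F \<in> ?f ` ?A" "\<And>C. C \<in> ?A \<Longrightarrow> ?f C \<le> ex_num n H F"
    unfolding ex by (blast intro: Max_in Max_ge finite_imageI)+
  then show thesis using that by auto
qed

text \<open>A vertex with an irregular ball lies within distance \<open>L\<close> of a vertex of
  positive deficit. Each of the latter contributes at least 1 to the total deficit, and its ball has
  at most \<open>(k + 1) ^ L\<close> vertices.\<close>

lemma few_irregular_balls: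
  assumes C: "C \<subseteq> all_edges {..<n}" and deg: "\<And>v. v < n \<Longrightarrow> card (nbrs C v) \<le> k"
  shows "real n - (\<Sum>a<n. deficit k C a) * real ((k + 1) ^ L)
    \<le> real (card {v \<in> {..<n}. regular_ball k L C v})"
proof -
  let ?good = "{v \<in> {..<n}. regular_ball k L C v}"
  let ?D = "{v \<in> {..<n}. card (nbrs C v) < k}"
  have near: "finite (near L C d)" "card (near L C d) \<le> (k + 1) ^ L" if "d < n" for d
    using card_near[OF finite_lessThan C, of k d L] deg that by auto
  have "{..<n} \<subseteq> ?good \<union> (\<Union>d \<in> ?D. near L C d)"
  proof
    fix v assume v: "v \<in> {..<n}"
    show "v \<in> ?good \<union> (\<Union>d \<in> ?D. near L C d)"
    proof (cases "regular_ball k L C v")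
      case False
      then obtain j y where y: "j \<le> L" "(v, y) \<in> adj C ^^ j" "card (nbrs C y) \<noteq> k"
        by (auto simp: regular_ball_def)
      have "y < n" using walk_in_verts[OF C v y(2)] by simp
      then have "y \<in> ?D" using y(3) deg[of y] by simp
      moreover have "v \<in> near L C y" by (rule near_sym) (use y(1,2) in \<open>auto simp: near_def\<close>)
      ultimately show ?thesis by blast
    qed (use v in simp)
  qed
  then have "card {..<n} \<le> card (?good \<union> (\<Union>d \<in> ?D. near L C d))"
    using near by (intro card_mono) auto
  also have "\<dots> \<le> card ?good + card (\<Union>d \<in> ?D. near L C d)"
    by (rule card_Un_le)
  also have "card (\<Union>d \<in> ?D. near L C d) \<le> (\<Sum>d \<in> ?D. card (near L C d))"
    by (intro card_UN_le) simp
  also have "\<dots> \<le> card ?D * (k + 1) ^ L"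
    using sum_bounded_above[of ?D "\<lambda>d. card (near L C d)" "(k + 1) ^ L"] near by simp
  finally have "n \<le> card ?good + card ?D * (k + 1) ^ L" by simp
  then have "real n \<le> real (card ?good + card ?D * (k + 1) ^ L)" by (rule of_nat_mono)
  then have "real n \<le> real (card ?good) + real (card ?D) * real ((k + 1) ^ L)"
    by (simp only: of_nat_add of_nat_mult)
  moreover have "real (card ?D) \<le> (\<Sum>a<n. deficit k C a)"
  proof -
    have "real (card ?D) = (\<Sum>a\<in>?D. 1)" by simp
    also have "\<dots> \<le> (\<Sum>a<n. deficit k C a)"
    proof (rule sum_le_included[where i = id])
      show "\<forall>x\<in>?D. \<exists>y\<in>{..<n}. id y = x \<and> 1 \<le> deficit k C y"
        by (auto simp: deficit_def)
    qed (use deg in \<open>auto simp: deficit_def\<close>)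
    finally show ?thesis .
  qed
  then have "real (card ?D) * real ((k + 1) ^ L) \<le> (\<Sum>a<n. deficit k C a) * real ((k + 1) ^ L)"
    by (intro mult_right_mono) auto
  ultimately show ?thesis by linarith
qed

lemma strategy_inv_initial: "strategy_inv V k L {} {}"
proof -
  have "weight_deg V {} w a = 0" for w :: "'a \<Rightarrow> real" and a by (simp add: weight_deg_def)
  moreover have "0 \<le> (\<Sum>a\<in>V. deficit k {} a)" by (intro sum_nonneg) (simp add: deficit_def nbrs_def)
  ultimately show ?thesis
    by (simp add: strategy_inv_def no_short_cycle_def controlled_def linear_pot_def square_pot_def nbrs_def)
qed

theorem theorem1p2:
  fixes k :: nat and T :: "'a graph"
  assumes "k \<ge> 2" and "tree T" and "max_degree T \<le> k"
  shows "\<exists>c::real. \<forall>n::nat.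
    real (ex_num n T (star (k + 1))) - c \<le> real (game_num n T (star (k + 1))) \<and>
    game_num n T (star (k + 1)) \<le> ex_num n T (star (k + 1))"
proof -
  let ?F = "star (k + 1)" and ?L = "card (verts T)" and ?A = "real (card (automorphisms T))"
  obtain P where P: "\<forall>G :: nat graph. fin_graph G \<longrightarrow> (\<forall>y \<in> verts G. card (nbrs (edges G) y) \<le> k) \<longrightarrow>
      card (inj_homs T G) \<le> card (verts G) * P \<and> (no_short_cycle ?L (edges G) \<longrightarrow>
        card {v \<in> verts G. regular_ball k ?L (edges G) v} * P \<le> card (inj_homs T G))"
    using tree_homs_count[OF \<open>tree T\<close>, of k] by (elim exE)
  have T: "fin_graph T" and L: "?L \<ge> 1"
    using \<open>tree T\<close> by (auto simp: tree_def connected_graph_def fin_graph_def card_gt_0_iff Suc_le_eq)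
  have A: "?A > 0" using card_automorphisms_pos[OF T] by simp
  have homs: "real (card (inj_homs T ({..<n}, C))) = ?A * real (card (copies T ({..<n}, C)))"
    if "C \<subseteq> all_edges {..<n}" for n :: nat and C
    using card_inj_homs[OF T, of "({..<n}, C)"] that by (simp add: fin_graph_def)
  \<comment> \<open>Once the total deficit is small, at most \<open>d\<close> vertices have
    irregular balls. Each costs at most \<open>P\<close> embeddings, and division by the number of
    automorphisms converts this into copies.\<close>
  define d where "d = deficit_bound k ?L * real ((k + 1) ^ ?L)"
  define c where "c = d * real P / ?A"
  have "real (ex_num n T ?F) - c \<le> real (game_num n T ?F) \<and> game_num n T ?F \<le> ex_num n T ?F" for n
  proof
    have free: "\<not> contains_copy ?F ({..<n}, {} :: nat set set)"
      by (subst contains_star_iff) (auto simp: fin_graph_def nbrs_def)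
    obtain C where C: "C \<subseteq> all_edges {..<n}" "\<not> contains_copy ?F ({..<n}, C)"
        "ex_num n T ?F = card (copies T ({..<n}, C))"
      and ex_max: "\<And>C. C \<subseteq> all_edges {..<n} \<Longrightarrow> \<not> contains_copy ?F ({..<n}, C) \<Longrightarrow>
        card (copies T ({..<n}, C)) \<le> ex_num n T ?F"
      using ex_num_attained[OF free, where H = T] by metis
    show "game_num n T ?F \<le> ex_num n T ?F"
      using game_value_final_graph[OF _ free, of T Constructor "{}"] ex_max
      by (auto simp: game_num_def)
    have "fin_graph ({..<n}, C)" using C(1) by (simp add: fin_graph_def)
    then have "card (inj_homs T ({..<n}, C)) \<le> n * P"
      using P[THEN spec, of "({..<n}, C)"] C(2) contains_star_iff[of "({..<n}, C)" "k + 1"]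
      by (auto simp: not_le less_Suc_eq_le)
    then have "?A * real (ex_num n T ?F) \<le> real n * real P"
      unfolding C(3) homs[OF C(1), symmetric] by (metis of_nat_le_iff of_nat_mult)
    then have ex_le: "real (ex_num n T ?F) \<le> real n * real P / ?A"
      using A by (simp add: pos_le_divide_eq mult.commute)
    \<comment> \<open>The score is compared with the upper bound in \<open>ex_le\<close>, not with
      an extremal graph.\<close>
    have "real n * real P / ?A - c \<le> real (game_value n T ?F Constructor {} {})"
    proof (rule game_value_strategy[OF _ L _ strategy_inv_initial])
      fix C B assume inv: "strategy_inv {..<n} k ?L C B"
        and small: "(\<Sum>a<n. deficit k C a) \<le> deficit_bound k ?L"
      have C: "C \<subseteq> all_edges {..<n}" and deg: "\<And>v. v < n \<Longrightarrow> card (nbrs C v) \<le> k"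
        and short: "no_short_cycle ?L C"
        using inv by (auto simp: strategy_inv_def)
      let ?good = "real (card {v \<in> {..<n}. regular_ball k ?L C v})"
      have "(\<Sum>a<n. deficit k C a) * real ((k + 1) ^ ?L) \<le> d"
        unfolding d_def using small by (intro mult_right_mono) auto
      then have "real n - d \<le> ?good" using few_irregular_balls[OF C deg, of ?L] by linarith
      then have "(real n - d) * real P \<le> ?good * real P" by (intro mult_right_mono) auto
      also have "\<dots> \<le> real (card (inj_homs T ({..<n}, C)))"
        using P[THEN spec, of "({..<n}, C)"] C deg short
        by (simp add: fin_graph_def flip: of_nat_mult)
      also have "\<dots> = ?A * real (card (copies T ({..<n}, C)))" using C by (rule homs)
      finally show "real n * real P / ?A - c \<le> real (card (copies T ({..<n}, C)))"
        using A by (simp add: c_def diff_divide_distrib[symmetric] pos_divide_le_eq algebra_simps)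
    qed (use \<open>k \<ge> 2\<close> in auto)
    then show "real (ex_num n T ?F) - c \<le> real (game_num n T ?F)"
      using ex_le by (simp add: game_num_def)
  qed
  then show ?thesis by blast
qed

end
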